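(* Let $A:\mathbb{R}^d\to\mathbb{R}^d$ be an expansive dilation and let $G\subseteq\mathbb{R}^d$ be an $A^*$-invariant measurable set. If $\Psi=\{\psi^\alpha\}_{\alpha=1}^N$ is a semiorthogonal tight frame multiwavelet of $H^2_G$, then for any $1\le\alpha\le N$ the origin is a point of $A^*$-approximate continuity of $\widehat{\psi^\alpha}$ if we put $\widehat{\psi^\alpha}(0)=0$.
   Context: Conventions: $\widehat f(\xi)=\int_{\mathbb{R}^d}f(x)e^{-2\pi i x\cdot\xi}dx$ for $f\in L^1\cap L^2$, extended to $L^2(\mathbb{R}^d)$; $|E|$ is Lebesgue measure; $\mathrm{Supp}(f)=\{x: f(x)\neq0\}$; $B_r$ is the open ball of radius $r$ centred at the origin; set relations depending on $L^2$ functions are up to null sets. A linear map $A:\mathbb{R}^d\to\mathbb{R}^d$ is an expansive dilation if $A(\mathbb{Z}^d)\subseteq\mathbb{Z}^d$ and all (complex) eigenvalues of $A$ have modulus strictly greater than $1$; $d_A=|\det A|$; $A^*$ is the adjoint; $\mathcal{D}_Af(x)=d_A^{1/2}f(Ax)$ on $L^2(\mathbb{R}^d)$. A measurable set $G$ is $A^*$-invariant if $A^*G=G$, and $H^2_G=\{f\in L^2(\mathbb{R}^d):\mathrm{Supp}\,\widehat f\subseteq G\}$. For a finite system $\Psi=\{\psi^\alpha\}_{\alpha=1}^N\subseteq L^2(\mathbb{R}^d)$ put $\psi^\alpha_{(j,k)}=d_A^{j/2}\psi^\alpha(A^j\cdot-k)$, $X(\Psi)=\{\psi^\alpha_{(j,k)}:j\in\mathbb{Z},k\in\mathbb{Z}^d,1\le\alpha\le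 N\}$, and let $W(\Psi)$ be the closed linear span of $\{\psi^\alpha_{(0,k)}:k\in\mathbb{Z}^d,1\le\alpha\le N\}$. $\Psi$ is a tight frame multiwavelet of $H^2_G$ if $X(\Psi)$ is a tight frame of $H^2_G$, i.e. $X(\Psi)\subseteq H^2_G$ and $\sum_{\alpha=1}^N\sum_{j\in\mathbb{Z}}\sum_{k\in\mathbb{Z}^d}|\langle f,\psi^\alpha_{(j,k)}\rangle|^2=\|f\|^2$ for all $f\in H^2_G$. It is semiorthogonal if in addition the subspaces $\mathcal{D}_A^jW(\Psi)$, $j\in\mathbb{Z}$, are mutually orthogonal. The origin is a point of $A^*$-density for a measurable set $E\subseteq\mathbb{R}^d$ of positive measure if $\lim_{j\to\infty}|E\cap A^{*-j}B_r|/|A^{*-j}B_r|=1$ for all $r>0$. For a measurable $f:\mathbb{R}^d\to\mathbb{C}$, the origin is a point of $A^*$-approximate continuity of $f$ if there is a measurable $E\subseteq\mathbb{R}^d$ of positive measure such that the origin is a point of $A^*$-density for $E$ and $\lim_{x\to0,\,x\in E}f(x)=f(0)$. *)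

theory Defs
  imports "HOL-Analysis.Analysis"
begin

text \<open>
  Elements of \<open>L\<^sup>2\<close> are represented by Lebesgue measurable functions; relations between classes
  are expressed by statements that do not depend on the representative.
\<close>

definition L2 :: "(real^'n \<Rightarrow> complex) set" where
  "L2 = {f \<in> borel_measurable lebesgue. integrable lebesgue (\<lambda>x. (cmod (f x))\<^sup>2)}"

definition L2_norm :: "(real^'n \<Rightarrow> complex) \<Rightarrow> real" where
  "L2_norm f = sqrt (LINT x|lebesgue. (cmod (f x))\<^sup>2)"

definition L2_inner :: "(real^'n \<Rightarrow> complex) \<Rightarrow> (real^'n \<Rightarrow> complex) \<Rightarrow> complex" where
  "L2_inner f g = (LINT x|lebesgue. f x * cnj (g x))"

definition fourier :: "(real^'n \<Rightarrow> complex) \<Rightarrow> real^'n \<Rightarrow> complex" where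
  "fourier f \<xi> =
     (LINT x|lebesgue. f x * exp (- (2 * complex_of_real pi * \<i> * complex_of_real (x \<bullet> \<xi>))))"

text \<open>
  \<open>g\<close> is a representative of the Fourier transform of \<open>f\<close>, where the transform is extended by
  continuity from \<open>L\<^sup>1 \<inter> L\<^sup>2\<close> to \<open>L\<^sup>2\<close>. By Plancherel's theorem the condition \<open>fourier (u n) \<in> L2\<close>
  is automatic; it is listed because \<open>L2_norm\<close> is meaningful on \<open>L2\<close> only.
\<close>

definition is_L2_fourier :: "(real^'n \<Rightarrow> complex) \<Rightarrow> (real^'n \<Rightarrow> complex) \<Rightarrow> bool" where
  "is_L2_fourier f g \<longleftrightarrow> f \<in> L2 \<and> g \<in> L2 \<and>
     (\<exists>u. (\<forall>n::nat. integrable lebesgue (u n) \<and> u n \<in> L2 \<and> fourier (u n) \<in> L2) \<and>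
          (\<lambda>n. L2_norm (\<lambda>x. u n x - f x)) \<longlonglongrightarrow> 0 \<and>
          (\<lambda>n. L2_norm (\<lambda>\<xi>. fourier (u n) \<xi> - g \<xi>)) \<longlonglongrightarrow> 0)"

definition H2 :: "(real^'n) set \<Rightarrow> (real^'n \<Rightarrow> complex) set" where
  "H2 G = {f \<in> L2. \<exists>g. is_L2_fourier f g \<and> (AE \<xi> in lebesgue. g \<xi> \<noteq> 0 \<longrightarrow> \<xi> \<in> G)}"

text \<open>Integer iterates of a bijection.\<close>

definition int_funpow :: "('a \<Rightarrow> 'a) \<Rightarrow> int \<Rightarrow> 'a \<Rightarrow> 'a" where
  "int_funpow F j = (if 0 \<le> j then F ^^ nat j else inv F ^^ nat (- j))"

definition int_lattice :: "(real^'n) set" where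
  "int_lattice = {k. \<forall>i. k $ i \<in> \<int>}"

definition complex_eigenvalue :: "(real^'n \<Rightarrow> real^'n) \<Rightarrow> complex \<Rightarrow> bool" where
  "complex_eigenvalue A z \<longleftrightarrow>
     (\<exists>v::complex^'n. v \<noteq> 0 \<and> (\<chi> i j. complex_of_real (matrix A $ i $ j)) *v v = z *s v)"

definition expansive_dilation :: "(real^'n \<Rightarrow> real^'n) \<Rightarrow> bool" where
  "expansive_dilation A \<longleftrightarrow> linear A \<and> A ` int_lattice \<subseteq> int_lattice \<and>
     (\<forall>z. complex_eigenvalue A z \<longrightarrow> cmod z > 1)"

definition abs_det :: "(real^'n \<Rightarrow> real^'n) \<Rightarrow> real" where
  "abs_det A = \<bar>det (matrix A)\<bar>"

definition dilation_op ::
    "(real^'n \<Rightarrow> real^'n) \<Rightarrow> (real^'n \<Rightarrow> complex) \<Rightarrow> real^'n \<Rightarrow> complex" where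
  "dilation_op A f x = complex_of_real (abs_det A powr (1/2)) * f (A x)"

definition wavelet_elem ::
    "(real^'n \<Rightarrow> real^'n) \<Rightarrow> (real^'n \<Rightarrow> complex) \<Rightarrow> int \<Rightarrow> real^'n \<Rightarrow> real^'n \<Rightarrow> complex" where
  "wavelet_elem A \<psi> j k x =
     complex_of_real (abs_det A powr (real_of_int j / 2)) * \<psi> (int_funpow A j x - k)"

definition affine_system ::
    "(real^'n \<Rightarrow> real^'n) \<Rightarrow> nat \<Rightarrow> (nat \<Rightarrow> real^'n \<Rightarrow> complex) \<Rightarrow> (real^'n \<Rightarrow> complex) set" where
  "affine_system A N \<psi> = {wavelet_elem A (\<psi> \<alpha>) j k | \<alpha> j k. \<alpha> \<in> {1..N} \<and> k \<in> int_lattice}"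

definition L2_closed_span :: "(real^'n \<Rightarrow> complex) set \<Rightarrow> (real^'n \<Rightarrow> complex) set" where
  "L2_closed_span S = {f \<in> L2. \<forall>\<epsilon>>0. \<exists>T c. finite T \<and> T \<subseteq> S \<and>
      L2_norm (\<lambda>x. f x - (\<Sum>u\<in>T. c u * u x)) < \<epsilon>}"

definition W_space ::
    "(real^'n \<Rightarrow> real^'n) \<Rightarrow> nat \<Rightarrow> (nat \<Rightarrow> real^'n \<Rightarrow> complex) \<Rightarrow> (real^'n \<Rightarrow> complex) set" where
  "W_space A N \<psi> =
     L2_closed_span {wavelet_elem A (\<psi> \<alpha>) 0 k | \<alpha> k. \<alpha> \<in> {1..N} \<and> k \<in> int_lattice}"

definition tight_frame_multiwavelet ::
    "(real^'n \<Rightarrow> real^'n) \<Rightarrow> (real^'n) set \<Rightarrow> nat \<Rightarrow> (nat \<Rightarrow> real^'n \<Rightarrow> complex) \<Rightarrow> bool" where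
  "tight_frame_multiwavelet A G N \<psi> \<longleftrightarrow>
     (\<forall>\<alpha>\<in>{1..N}. \<psi> \<alpha> \<in> L2) \<and>
     affine_system A N \<psi> \<subseteq> H2 G \<and>
     (\<forall>f\<in>H2 G. ((\<lambda>(\<alpha>, j, k). (cmod (L2_inner f (wavelet_elem A (\<psi> \<alpha>) j k)))\<^sup>2)
                 has_sum (L2_norm f)\<^sup>2) ({1..N} \<times> UNIV \<times> int_lattice))"

definition semiorthogonal ::
    "(real^'n \<Rightarrow> real^'n) \<Rightarrow> nat \<Rightarrow> (nat \<Rightarrow> real^'n \<Rightarrow> complex) \<Rightarrow> bool" where
  "semiorthogonal A N \<psi> \<longleftrightarrow>
     (\<forall>i j. i \<noteq> j \<longrightarrow>
        (\<forall>f \<in> int_funpow (dilation_op A) i ` W_space A N \<psi>.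
         \<forall>g \<in> int_funpow (dilation_op A) j ` W_space A N \<psi>. L2_inner f g = 0))"

text \<open>The next two notions are stated for a map \<open>M\<close>, to be instantiated with \<open>A\<^sup>*\<close>.\<close>

definition density_point_origin :: "(real^'n \<Rightarrow> real^'n) \<Rightarrow> (real^'n) set \<Rightarrow> bool" where
  "density_point_origin M E \<longleftrightarrow> E \<in> sets lebesgue \<and> emeasure lebesgue E > 0 \<and>
     (\<forall>r>0. (\<lambda>j::nat. measure lebesgue (E \<inter> int_funpow M (- int j) ` ball 0 r) /
                       measure lebesgue (int_funpow M (- int j) ` ball 0 r)) \<longlonglongrightarrow> 1)"

definition approx_continuous_origin ::
    "(real^'n \<Rightarrow> real^'n) \<Rightarrow> (real^'n \<Rightarrow> complex) \<Rightarrow> bool" where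
  "approx_continuous_origin M f \<longleftrightarrow>
     (\<exists>E. density_point_origin M E \<and> (f \<longlongrightarrow> f 0) (at 0 within E))"

end

(*
  Let w be a Gaussian. The point is that the weighted norms of g(A*^(-j) .) with weight w,
  where g is the Fourier transform of psi^alpha, are summable over j >= 0.

  For a Gaussian h put Phi_j(y) = <psi_(j,0), h(. - y)>. The upper frame bound, which extends from
  H^2_G to all of L^2, bounds the sums of |Phi_j(y - A^(-j) k)|^2 over j and over k in the lattice
  by ||h||^2 for every y. Averaging over y in a large ball and counting lattice points bounds the
  sum of d_A^j ||Phi_j||^2. On the other hand ||Phi_j||^2 dominates a multiple of the weighted norm
  of the Fourier transform of psi_(j,0), because the two quadratic forms have proportional
  Gaussian Gram kernels, and dilation turns this into the weighted norm of g(A*^(-j) .).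

  Hence these weighted norms tend to 0, and by absolute continuity of the integral one finds radii
  r_n such that the part of the j-th norm coming from A*^(-j) xi in B_(r_n) is at most
  2^(-n)/(n+1) for all j. The set of eta such that |g(eta)|^2 <= 1/(n+1) whenever |eta| < r_n
  is then the required E.
*)

theory Submission imports Defs "HOL-Probability.Probability"
begin

text \<open>Two powers of d_A cancel. The squared modulus of the transform of psi_(j,0) is d_A^(-j)
  times that of g composed with A*^(-j), whereas the lattice A^(-j) Z^d has d_A^j points per unit
  volume. Sampling Phi_j on that lattice is therefore worth d_A^j times its integral, and the bound
  for one test function h controls all scales at once.

  Two obstacles shape the proof. A Gaussian need not lie in H^2_G, so the frame identity cannot be
  applied to it directly. Also, the bound holds for each y separately and cannot be integrated over
  the whole space; only a local average is available, and enlarging the ball to absorb the lattice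
  shifts costs the factor 3^d, which does not depend on the radius.

  Gaussians are used because both Gram kernels are then explicit, and are multiples of exp(-2 pi^2
  |x-y|^2). The comparison of norms is then an application of Fubini for integrable functions, and
  approximating sequences carry it to L^2. A single Gaussian weight serves every ball in the
  definition of density, as it is at least exp(-R^2/2) on B_R. The factor 1/(n+1) in the choice of
  r_n pays for Chebyshev's inequality, and 2^(-n) makes the exceptional sets summable.\<close>

section \<open>Affine changes of variables\<close>

lemma linear_borel_measurable:
  fixes f :: "'a::euclidean_space \<Rightarrow> 'b::euclidean_space"
  shows "linear f \<Longrightarrow> f \<in> borel_measurable borel"
  by (auto intro!: borel_measurable_continuous_onI linear_continuous_on linear_conv_bounded_linear[THEN iffD1])

lemma
  shows linear_identity: "linear (\<lambda>x::real^'n. x)"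
    and det_matrix_identity: "det (matrix (\<lambda>x::real^'n. x)) = 1"
proof -
  show "linear (\<lambda>x::real^'n. x)" by (rule linearI) auto
  have "matrix (\<lambda>x::real^'n. x) = mat 1" by (simp add: matrix_def mat_def axis_def vec_eq_iff)
  then show "det (matrix (\<lambda>x::real^'n. x)) = 1" by simp
qed

text \<open>
  The library states the determinant formula for the image measure only for index types in class
  \<open>wellorder\<close>; the order serves there just to compute the determinant of a shear.
\<close>

lemma distr_lborel_shear:
  fixes m n :: "'n::finite"
  assumes "m \<noteq> n"
  shows "distr lborel borel (\<lambda>x::real^'n. \<chi> i. if i = m then x$m + x$n else x$i) = lborel"
proof -
  let ?h = "\<lambda>x::real^'n. \<chi> i. if i = m then x$m + x$n else x$i"
  let ?k = "\<lambda>x::real^'n. \<chi> i. if i = m then x$m - x$n else x$i"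
  have lin: "linear ?h" "linear ?k"
    by (rule linearI; simp add: vec_eq_iff algebra_simps)+
  have [measurable]: "?h \<in> borel_measurable borel" "?k \<in> borel_measurable borel"
    using lin by (auto intro: linear_borel_measurable)
  have hk: "?h (?k x) = x" "?k (?h x) = x" for x
    using assms by (simp_all add: vec_eq_iff)
  have cbox: "measure lebesgue (?h ` cbox a b) = 1 * measure lebesgue (cbox a b)" for a b
  proof (cases "cbox a b = {}")
    case False
    \<comment> \<open>\<open>measure_shear_interval\<close> needs a nonnegative lower bound in
      coordinate \<open>n\<close>; this translation moves that bound to 0.\<close>
    let ?t = "axis n (a$n) :: real^'n"
    have cb: "cbox a b = (+) ?t ` cbox (a - ?t) (b - ?t)"
      using cbox_translation[of ?t "a - ?t" "b - ?t"] by simp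
    have im: "?h ` cbox a b = (+) (?h ?t) ` (?h ` cbox (a - ?t) (b - ?t))"
      unfolding cb image_image using linear_add[OF lin(1)] by (intro image_cong) auto
    have ne: "cbox (a - ?t) (b - ?t) \<noteq> {}" using False cb by auto
    have "measure lebesgue (?h ` cbox a b) = measure lebesgue (cbox (a - ?t) (b - ?t))"
      unfolding im measure_translation by (rule measure_shear_interval[OF assms ne]) simp
    also have "\<dots> = measure lebesgue (cbox a b)" unfolding cb measure_translation ..
    finally show ?thesis by simp
  qed simp
  have meas: "?h ` S \<in> lmeasurable \<and> measure lebesgue (?h ` S) = measure lebesgue S"
    if "S \<in> lmeasurable" for S
    using measure_linear_sufficient[OF lin(1) that cbox] by simp
  \<comment> \<open>The inverse shear comes first: the preimage of a box under \<open>?k\<close> is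
    its image under \<open>?h\<close>, whose volume is known. Pushing forward by \<open>?h\<close>
    afterwards gives the claim.\<close>
  have "lborel = distr lborel borel ?k"
  proof (rule lborel_eqI)
    fix l u :: "real^'n" assume le: "\<And>b. b \<in> Basis \<Longrightarrow> l \<bullet> b \<le> u \<bullet> b"
    have pre: "?k -` box l u = ?h ` box l u"
      using hk by (auto simp: image_iff intro!: bexI[of _ "?k _"])
    have "emeasure (distr lborel borel ?k) (box l u) = emeasure lborel (?h ` box l u)"
      by (subst emeasure_distr) (simp_all add: pre)
    also have "\<dots> = emeasure lebesgue (?h ` box l u)"
      using measurable_sets[of ?k borel borel "box l u"] pre by (simp add: emeasure_completion)
    also have "\<dots> = emeasure lebesgue (box l u)"
      using meas[of "box l u"] by (simp add: emeasure_eq_measure2)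
    finally show "emeasure (distr lborel borel ?k) (box l u) = (\<Prod>b\<in>Basis. (u - l) \<bullet> b)"
      using le by (simp add: emeasure_lborel_box_eq)
  qed simp
  then have "distr lborel borel ?h = distr (distr lborel borel ?k) borel ?h" by simp
  also have "\<dots> = distr lborel borel (\<lambda>x. x)"
    by (subst distr_distr) (auto simp: o_def hk)
  finally show ?thesis by (simp add: distr_id2)
qed

lemma det_shear:
  fixes m n :: "'n::finite"
  assumes "m \<noteq> n"
  shows "det (matrix (\<lambda>x::real^'n. \<chi> i. if i = m then x$m + x$n else x$i)) = 1"
proof -
  have "matrix (\<lambda>x::real^'n. \<chi> i. if i = m then x$m + x$n else x$i) =
      (\<chi> k. if k = m then row m (mat 1) + 1 *s row n (mat 1) else row k (mat 1 :: real^'n^'n))"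
    by (auto simp: matrix_def row_def mat_def axis_def vec_eq_iff)
  then show ?thesis using det_row_operation[OF assms, of "mat 1 :: real^'n^'n" 1] by simp
qed

text \<open>By induction over a factorisation into elementary maps: the constants multiply under
  composition just as determinants do, and diagonal maps, coordinate swaps and shears are computed
  directly.\<close>

lemma distr_lborel_linear:
  fixes f :: "real^'n \<Rightarrow> real^'n"
  assumes "linear f" "det (matrix f) \<noteq> 0"
  shows "density (distr lborel borel f) (\<lambda>_. ennreal \<bar>det (matrix f)\<bar>) = lborel"
proof -
  \<comment> \<open>The condition on the determinant belongs to the induction predicate, since the
    elementary maps include singular ones.\<close>
  let ?P = "\<lambda>f::real^'n \<Rightarrow> real^'n. det (matrix f) \<noteq> 0 \<longrightarrow>
    density (distr lborel borel f) (\<lambda>_. ennreal \<bar>det (matrix f)\<bar>) = lborel"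
  have "?P f"
  proof (rule induct_linear_elementary[OF \<open>linear f\<close>])
    fix f g :: "real^'n \<Rightarrow> real^'n"
    assume lin: "linear f" "linear g" and P: "?P f" "?P g"
    have [measurable]: "f \<in> borel_measurable borel" "g \<in> borel_measurable borel"
      using lin linear_borel_measurable by auto
    have det: "det (matrix (f \<circ> g)) = det (matrix f) * det (matrix g)"
      using lin by (simp add: matrix_compose det_mul)
    show "?P (f \<circ> g)"
    proof
      assume nz: "det (matrix (f \<circ> g)) \<noteq> 0"
      then have eqs: "density (distr lborel borel f) (\<lambda>_. ennreal \<bar>det (matrix f)\<bar>) = lborel"
        "density (distr lborel borel g) (\<lambda>_. ennreal \<bar>det (matrix g)\<bar>) = lborel"
        using det P by auto
      have "lborel = density (distr (density (distr lborel borel g) (\<lambda>_. ennreal \<bar>det (matrix g)\<bar>)) borel f)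
          (\<lambda>_. ennreal \<bar>det (matrix f)\<bar>)"
        using eqs by simp
      also have "\<dots> = density (distr lborel borel (f \<circ> g)) (\<lambda>_. ennreal \<bar>det (matrix (f \<circ> g))\<bar>)"
      proof (rule measure_eqI)
        fix A assume "A \<in> sets (density (distr (density (distr lborel borel g) (\<lambda>_. ennreal \<bar>det (matrix g)\<bar>)) borel f)
          (\<lambda>_. ennreal \<bar>det (matrix f)\<bar>))"
        then have A[measurable]: "A \<in> sets borel" by simp
        have fA[measurable]: "f -` A \<in> sets borel"
          using measurable_sets_borel[of f borel A] by simp
        show "emeasure (density (distr (density (distr lborel borel g) (\<lambda>_. ennreal \<bar>det (matrix g)\<bar>)) borel f)
            (\<lambda>_. ennreal \<bar>det (matrix f)\<bar>)) A =
          emeasure (density (distr lborel borel (f \<circ> g)) (\<lambda>_. ennreal \<bar>det (matrix (f \<circ> g))\<bar>)) A"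
          by (simp add: det emeasure_density_const emeasure_distr abs_mult ennreal_mult mult.assoc
              vimage_comp)
      qed simp
      finally show "density (distr lborel borel (f \<circ> g)) (\<lambda>_. ennreal \<bar>det (matrix (f \<circ> g))\<bar>) = lborel" ..
    qed
  next
    fix f :: "real^'n \<Rightarrow> real^'n" and i
    assume lin: "linear f" and 0: "\<And>x. f x $ i = 0"
    have "\<not> surj f" by (metis 0 one_neq_zero surjE vec_component)
    then have "det (matrix f) = 0"
      using lin det_nz_iff_inj linear_injective_imp_surjective by blast
    then show "?P f" by simp
  next
    fix c :: "'n \<Rightarrow> real"
    let ?f = "\<lambda>x::real^'n. \<chi> i. c i * x$i"
    have det: "det (matrix ?f) = prod c UNIV"
      by (simp add: axis_def matrix_def det_diagonal)
    show "?P ?f"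
    proof
      assume nz: "det (matrix ?f) \<noteq> 0"
      then have c: "c i \<noteq> 0" for i by (simp add: det)
      let ?c = "\<lambda>b::real^'n. c (axis_index b)"
      have ax: "axis_index (axis i (1::real)) = i" for i :: 'n
        by (rule axis_index_axis) 
      have bij: "bij_betw (\<lambda>i. axis i (1::real)) UNIV (Basis :: (real^'n) set)"
        by (auto simp: bij_betw_def inj_on_def axis_eq_axis Basis_vec_def)
      have f: "?f = (\<lambda>x. 0 + (\<Sum>j\<in>Basis. (?c j * (x \<bullet> j)) *\<^sub>R j))"
      proof
        fix x :: "real^'n"
        show "?f x = 0 + (\<Sum>j\<in>Basis. (?c j * (x \<bullet> j)) *\<^sub>R j)"
          using sum.reindex_bij_betw[OF bij, of "\<lambda>j. (?c j * (x \<bullet> j)) *\<^sub>R j"]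
          by (simp add: vec_eq_iff ax cart_eq_inner_axis[symmetric])
            (simp add: axis_def if_distrib cong: if_cong)
      qed
      from prod.reindex_bij_betw[OF bij, of "\<lambda>j. \<bar>?c j\<bar>"]
      have "(\<Prod>j\<in>Basis. \<bar>?c j\<bar>) = \<bar>prod c UNIV\<bar>"
        by (simp add: ax abs_prod)
      then show "density (distr lborel borel ?f) (\<lambda>_. ennreal \<bar>det (matrix ?f)\<bar>) = lborel"
        using lborel_affine_euclidean[of ?c 0] c unfolding f[symmetric] det by simp
    qed
  next
    fix m n :: 'n assume "m \<noteq> n"
    let ?f = "\<lambda>x::real^'n. \<chi> i. x $ Transposition.transpose m n i"
    have "matrix ?f = transpose (\<chi> i j. mat 1 $ i $ Transposition.transpose m n j)"
      by (auto simp: transpose_def axis_def mat_def matrix_def vec_eq_iff)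
    then have det: "\<bar>det (matrix ?f)\<bar> = 1"
      by (simp add: det_permute_columns permutes_swap_id sign_swap_id abs_mult)
    have lin: "linear ?f" by (rule linearI) (simp_all add: vec_eq_iff)
    note [measurable] = linear_borel_measurable[OF lin]
    have "lborel = distr lborel borel ?f"
    proof (rule lborel_eqI)
      fix l u :: "real^'n" assume "\<And>b. b \<in> Basis \<Longrightarrow> l \<bullet> b \<le> u \<bullet> b"
      then have le: "l$i \<le> u$i" for i
        by (metis cart_eq_inner_axis axis_in_Basis_iff Basis_real_def singletonI)
      have pre: "?f -` box l u = box (?f l) (?f u)"
        by (auto simp: mem_box_cart) (metis transpose_involutory)+
      have prod: "(\<Prod>b\<in>Basis. (u - l) \<bullet> b) = (\<Prod>i\<in>UNIV. u$i - l$i)" for u l :: "real^'n"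
      proof -
        have "bij_betw (\<lambda>i. axis i (1::real)) UNIV (Basis :: (real^'n) set)"
          by (auto simp: bij_betw_def inj_on_def axis_eq_axis Basis_vec_def)
        from prod.reindex_bij_betw[OF this, of "\<lambda>b. (u - l) \<bullet> b"]
        show ?thesis by (simp add: cart_eq_inner_axis[symmetric])
      qed
      have le': "?f l \<bullet> b \<le> ?f u \<bullet> b" if "b \<in> Basis" for b
        using that le by (auto simp: Basis_vec_def inner_axis)
      have "emeasure (distr lborel borel ?f) (box l u) = emeasure lborel (box (?f l) (?f u))"
        by (subst emeasure_distr) (simp_all add: pre)
      also have "\<dots> = (\<Prod>b\<in>Basis. (?f u - ?f l) \<bullet> b)"
        using le' by (subst emeasure_lborel_box_eq) (auto simp: prod)
      also have "(\<Prod>b\<in>Basis. (?f u - ?f l) \<bullet> b) = (\<Prod>b\<in>Basis. (u - l) \<bullet> b)"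
        unfolding prod using prod.permute[OF permutes_swap_id[of m UNIV n], of "\<lambda>i. u$i - l$i"]
        by (simp add: o_def)
      finally show "emeasure (distr lborel borel ?f) (box l u) = (\<Prod>b\<in>Basis. (u - l) \<bullet> b)" .
    qed simp
    then show "?P ?f" using det by (simp add: density_1)
  next
    fix m n :: 'n assume "m \<noteq> n"
    then show "?P (\<lambda>x. \<chi> i. if i = m then x$m + x$n else x$i)"
      by (simp add: det_shear distr_lborel_shear density_1)
  qed
  then show ?thesis using assms(2) by blast
qed

lemma distr_lborel_affine:
  fixes f :: "real^'n \<Rightarrow> real^'n"
  assumes "linear f" "det (matrix f) \<noteq> 0"
  shows "distr lborel borel (\<lambda>x. f x + t) = density lborel (\<lambda>_. ennreal (1 / \<bar>det (matrix f)\<bar>))"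
proof -
  let ?d = "\<bar>det (matrix f)\<bar>"
  have [measurable]: "f \<in> borel_measurable borel" using assms linear_borel_measurable by auto
  have inv: "ennreal ?d * ennreal (1 / ?d) = 1"
    using assms by (simp flip: ennreal_mult')
  have "density lborel (\<lambda>_. ennreal (1 / ?d)) =
      density (density (distr lborel borel f) (\<lambda>_. ennreal ?d)) (\<lambda>_. ennreal (1 / ?d))"
    using distr_lborel_linear[OF assms] by simp
  also have "\<dots> = distr lborel borel f"
    by (subst density_density_eq) (simp_all only: inv density_1, simp_all)
  finally have 1: "distr lborel borel f = density lborel (\<lambda>_. ennreal (1 / ?d))" ..
  have "distr lborel borel (\<lambda>x. f x + t) = distr (distr lborel borel f) borel (\<lambda>x. t + x)"
    by (subst distr_distr) (auto simp: o_def add.commute)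
  also have "\<dots> = density (distr lborel borel ((+) t)) (\<lambda>_. ennreal (1 / ?d))"
    unfolding 1
  proof (rule measure_eqI)
    fix A assume "A \<in> sets (distr (density lborel (\<lambda>_. ennreal (1 / ?d))) borel ((+) t))"
    then have A: "A \<in> sets borel" by simp
    then have "(+) t -` A \<in> sets borel"
      using measurable_sets_borel[of "(+) t" borel A] by simp
    then show "emeasure (distr (density lborel (\<lambda>_. ennreal (1 / ?d))) borel ((+) t)) A =
        emeasure (density (distr lborel borel ((+) t)) (\<lambda>_. ennreal (1 / ?d))) A"
      using A by (simp add: emeasure_density_const emeasure_distr)
  qed simp
  finally show ?thesis by (simp add: lborel_distr_plus)
qed

text \<open>The image of \<open>lborel\<close> is a positive multiple of \<open>lborel\<close>, so
  it has the same null sets. This gives measurability with respect to the completion, and completing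
  both sides of the Borel identity gives the second claim.\<close>

lemma distr_lebesgue_affine:
  fixes f :: "real^'n \<Rightarrow> real^'n"
  assumes "linear f" "det (matrix f) \<noteq> 0"
  shows "(\<lambda>x. f x + t) \<in> lebesgue \<rightarrow>\<^sub>M lebesgue"
    and "distr lebesgue lebesgue (\<lambda>x. f x + t) = density lebesgue (\<lambda>_. ennreal (1 / \<bar>det (matrix f)\<bar>))"
proof -
  let ?d = "ennreal (1 / \<bar>det (matrix f)\<bar>)" and ?T = "\<lambda>x. f x + t"
  have [measurable]: "f \<in> borel_measurable borel" using assms linear_borel_measurable by auto
  have d: "0 < ?d" using assms by simp
  have T: "?T \<in> lebesgue \<rightarrow>\<^sub>M lborel" by (rule measurable_completion) simp
  have "distr lebesgue lborel ?T = distr lborel lborel ?T" by (rule distr_completion) simp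
  also have "\<dots> = distr lborel borel ?T" by (rule distr_cong) auto
  finally have distr: "distr lebesgue lborel ?T = density lborel (\<lambda>_. ?d)"
    using distr_lborel_affine[OF assms] by simp
  have null: "null_sets (distr lebesgue lborel ?T) = null_sets lborel"
    unfolding distr using d by (auto simp: null_sets_def emeasure_density nn_integral_cmult)
  show "?T \<in> lebesgue \<rightarrow>\<^sub>M lebesgue"
    using null by (intro completion.measurable_completion2 T) auto
  have "distr lebesgue lebesgue ?T = completion (distr lebesgue lborel ?T)"
    by (rule completion.completion_distr_eq[symmetric, OF T null])
  also have "\<dots> = density lebesgue (\<lambda>_. ?d)"
    unfolding distr using d by (intro completion_density_eq) auto
  finally show "distr lebesgue lebesgue ?T = density lebesgue (\<lambda>_. ?d)" .
qed

section \<open>Substitution rules for Lebesgue integrals\<close>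

lemma measurable_lebesgue_affine:
  fixes f :: "real^'n \<Rightarrow> real^'n" and h :: "real^'n \<Rightarrow> 'b"
  assumes f: "linear f" "det (matrix f) \<noteq> 0"
  shows "h \<in> measurable lebesgue N \<Longrightarrow> (\<lambda>x. h (f x + t)) \<in> measurable lebesgue N"
  using measurable_compose[OF distr_lebesgue_affine(1)[OF f]] by blast

lemma nn_integral_lebesgue_affine:
  fixes f :: "real^'n \<Rightarrow> real^'n"
  assumes f: "linear f" "det (matrix f) \<noteq> 0" and h: "h \<in> borel_measurable lebesgue"
  shows "(\<integral>\<^sup>+x. h (f x + t) \<partial>lebesgue) = ennreal (1 / \<bar>det (matrix f)\<bar>) * (\<integral>\<^sup>+x. h x \<partial>lebesgue)"
proof -
  have "(\<integral>\<^sup>+x. h (f x + t) \<partial>lebesgue) = (\<integral>\<^sup>+x. h x \<partial>distr lebesgue lebesgue (\<lambda>x. f x + t))"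
    using h by (subst nn_integral_distr[OF distr_lebesgue_affine(1)[OF f]]) auto
  also have "\<dots> = ennreal (1 / \<bar>det (matrix f)\<bar>) * (\<integral>\<^sup>+x. h x \<partial>lebesgue)"
    unfolding distr_lebesgue_affine(2)[OF f] using h
    by (subst nn_integral_density) (auto simp: nn_integral_cmult)
  finally show ?thesis .
qed

lemma
  fixes f :: "real^'n \<Rightarrow> real^'n" and h :: "real^'n \<Rightarrow> 'b::{banach, second_countable_topology}"
  assumes f: "linear f" "det (matrix f) \<noteq> 0" and h: "h \<in> borel_measurable lebesgue"
  shows integrable_lebesgue_affine:
      "integrable lebesgue h \<Longrightarrow> integrable lebesgue (\<lambda>x. h (f x + t))"
    and integral_lebesgue_affine:
      "(LINT x|lebesgue. h (f x + t)) = (1 / \<bar>det (matrix f)\<bar>) *\<^sub>R (LINT x|lebesgue. h x)"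
proof -
  note T = distr_lebesgue_affine(1)[OF f, of t]
  have "(LINT x|lebesgue. h (f x + t)) = (LINT x|distr lebesgue lebesgue (\<lambda>x. f x + t). h x)"
    using h by (subst integral_distr[OF T]) auto
  also have "\<dots> = (LINT x|lebesgue. (1 / \<bar>det (matrix f)\<bar>) *\<^sub>R h x)"
    unfolding distr_lebesgue_affine(2)[OF f] using h by (subst integral_density) auto
  finally show "(LINT x|lebesgue. h (f x + t)) = (1 / \<bar>det (matrix f)\<bar>) *\<^sub>R (LINT x|lebesgue. h x)"
    by simp
  assume "integrable lebesgue h"
  then have "integrable (distr lebesgue lebesgue (\<lambda>x. f x + t)) h"
    unfolding distr_lebesgue_affine(2)[OF f] using h by (subst integrable_density) auto
  then show "integrable lebesgue (\<lambda>x. h (f x + t))"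
    using h by (subst (asm) integrable_distr_eq[OF T]) auto
qed

section \<open>Square-integrable functions\<close>

lemma cmod_add_square_le: "(cmod (a + b))\<^sup>2 \<le> 2 * (cmod a)\<^sup>2 + 2 * (cmod b)\<^sup>2"
proof -
  have "(cmod (a + b))\<^sup>2 \<le> (cmod a + cmod b)\<^sup>2"
    by (intro power_mono norm_triangle_ineq) auto
  also have "\<dots> \<le> 2 * (cmod a)\<^sup>2 + 2 * (cmod b)\<^sup>2"
    using sum_squares_bound[of "cmod a" "cmod b"] by (simp add: power2_sum)
  finally show ?thesis .
qed

lemma L2_measurable: "f \<in> L2 \<Longrightarrow> f \<in> borel_measurable lebesgue"
  and L2_integrable: "f \<in> L2 \<Longrightarrow> integrable lebesgue (\<lambda>x. (cmod (f x))\<^sup>2)"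
  by (auto simp: L2_def)

lemma L2_iff_nn_integral:
  "f \<in> L2 \<longleftrightarrow> f \<in> borel_measurable lebesgue \<and> (\<integral>\<^sup>+x. ennreal ((cmod (f x))\<^sup>2) \<partial>lebesgue) < \<infinity>"
  by (auto simp: L2_def integrable_iff_bounded)

lemma L2_norm_nonneg: "0 \<le> L2_norm f"
  by (simp add: L2_norm_def)

lemma L2_norm_square: "(L2_norm f)\<^sup>2 = (LINT x|lebesgue. (cmod (f x))\<^sup>2)"
  by (simp add: L2_norm_def)

lemma nn_integral_L2: "f \<in> L2 \<Longrightarrow> (\<integral>\<^sup>+x. ennreal ((cmod (f x))\<^sup>2) \<partial>lebesgue) = ennreal ((L2_norm f)\<^sup>2)"
  unfolding L2_norm_square by (intro nn_integral_eq_integral L2_integrable) auto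

lemma L2_add: "f \<in> L2 \<Longrightarrow> g \<in> L2 \<Longrightarrow> (\<lambda>x. f x + g x) \<in> L2"
  and L2_scale: "f \<in> L2 \<Longrightarrow> (\<lambda>x. c * f x) \<in> L2"
  and L2_diff: "f \<in> L2 \<Longrightarrow> g \<in> L2 \<Longrightarrow> (\<lambda>x. f x - g x) \<in> L2"
proof -
  show add: "(\<lambda>x. f x + g x) \<in> L2" if "f \<in> L2" "g \<in> L2" for f g :: "real^'n \<Rightarrow> complex"
  proof -
    note [measurable] = that[THEN L2_measurable]
    have "integrable lebesgue (\<lambda>x. (cmod (f x + g x))\<^sup>2)"
      by (rule Bochner_Integration.integrable_bound[of _ "\<lambda>x. 2 * (cmod (f x))\<^sup>2 + 2 * (cmod (g x))\<^sup>2"])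
        (use that[THEN L2_integrable] cmod_add_square_le in auto)
    then show ?thesis by (simp add: L2_def)
  qed
  show scale: "(\<lambda>x. c * f x) \<in> L2" if "f \<in> L2" for f :: "real^'n \<Rightarrow> complex" and c
    using that by (auto simp: L2_def norm_mult power_mult_distrib)
  show "(\<lambda>x. f x - g x) \<in> L2" if "f \<in> L2" "g \<in> L2" for f g :: "real^'n \<Rightarrow> complex"
    using add[OF that(1) scale[OF that(2), of "-1"]] by simp
qed

lemma L2_zero: "(\<lambda>x. 0) \<in> L2"
  by (simp add: L2_def)

lemma L2_sum: "(\<And>i. i \<in> I \<Longrightarrow> f i \<in> L2) \<Longrightarrow> (\<lambda>x. \<Sum>i\<in>I. f i x) \<in> L2"
  by (induction I rule: infinite_finite_induct) (auto intro: L2_zero L2_add)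

text \<open>A weak form of Minkowski's inequality. It serves for sums of two sequences tending to 0,
  where the constant 2 is harmless.\<close>

lemma L2_norm_add_square_le:
  assumes "f \<in> L2" "g \<in> L2"
  shows "(L2_norm (\<lambda>x. f x + g x))\<^sup>2 \<le> 2 * (L2_norm f)\<^sup>2 + 2 * (L2_norm g)\<^sup>2"
proof -
  have "(LINT x|lebesgue. (cmod (f x + g x))\<^sup>2) \<le> (LINT x|lebesgue. 2 * (cmod (f x))\<^sup>2 + 2 * (cmod (g x))\<^sup>2)"
    by (intro integral_mono L2_integrable L2_add assms cmod_add_square_le
        Bochner_Integration.integrable_add integrable_mult_right)
  then show ?thesis
    using assms[THEN L2_integrable] by (simp add: L2_norm_square)
qed

section \<open>The inner product, Cauchy-Schwarz and Bessel inequalities\<close>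

lemma borel_measurable_cnj[measurable]: "cnj \<in> borel_measurable borel"
  by (intro borel_measurable_continuous_onI continuous_intros)

lemma L2_inner_integrable:
  assumes "f \<in> L2" "g \<in> L2"
  shows "integrable lebesgue (\<lambda>x. f x * cnj (g x))"
proof -
  note [measurable] = assms[THEN L2_measurable]
  have "norm (f x * cnj (g x)) \<le> (cmod (f x))\<^sup>2 + (cmod (g x))\<^sup>2" for x
  proof -
    have "0 \<le> cmod (f x) * cmod (g x)" by simp
    moreover have "2 * (cmod (f x) * cmod (g x)) \<le> (cmod (f x))\<^sup>2 + (cmod (g x))\<^sup>2"
      using sum_squares_bound[of "cmod (f x)" "cmod (g x)"] by (simp add: mult.assoc)
    ultimately have "cmod (f x) * cmod (g x) \<le> (cmod (f x))\<^sup>2 + (cmod (g x))\<^sup>2" by linarith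
    then show ?thesis by (simp only: norm_mult complex_mod_cnj)
  qed
  then have le: "norm (f x * cnj (g x)) \<le> norm ((cmod (f x))\<^sup>2 + (cmod (g x))\<^sup>2)" for x
    by (rule order_trans) simp
  show ?thesis
    by (rule Bochner_Integration.integrable_bound[OF
          Bochner_Integration.integrable_add[OF assms[THEN L2_integrable]] _ AE_I2[OF le]]) measurable
qed

lemma L2_Cauchy_Schwarz:
  assumes "f \<in> L2" "g \<in> L2"
  shows "cmod (L2_inner f g) \<le> L2_norm f * L2_norm g"
proof -
  have int: "integrable lebesgue (\<lambda>x. cmod (f x) * cmod (g x))"
    using integrable_norm[OF L2_inner_integrable[OF assms]] by (simp add: norm_mult)
  define a b c where "a = (L2_norm f)\<^sup>2" and "b = (LINT x|lebesgue. cmod (f x) * cmod (g x))"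
    and "c = (L2_norm g)\<^sup>2"
  have "cmod (L2_inner f g) \<le> (LINT x|lebesgue. norm (f x * cnj (g x)))"
    unfolding L2_inner_def by (rule integral_norm_bound)
  then have le_b: "cmod (L2_inner f g) \<le> b" by (simp add: b_def norm_mult)
  have quad: "0 \<le> s\<^sup>2 * a - 2 * (s * t) * b + t\<^sup>2 * c" for s t :: real
  proof -
    have "0 \<le> (LINT x|lebesgue. (s * cmod (f x) - t * cmod (g x))\<^sup>2)" by simp
    also have "\<dots> = (LINT x|lebesgue. s\<^sup>2 * (cmod (f x))\<^sup>2 - 2 * (s * t) * (cmod (f x) * cmod (g x)) + t\<^sup>2 * (cmod (g x))\<^sup>2)"
      by (intro Bochner_Integration.integral_cong) (auto simp: power2_eq_square algebra_simps)
    also have "\<dots> = s\<^sup>2 * a - 2 * (s * t) * b + t\<^sup>2 * c"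
      using int assms[THEN L2_integrable] by (simp add: a_def b_def c_def L2_norm_square)
    finally show ?thesis .
  qed
  have "b\<^sup>2 \<le> a * c"
  proof (cases "c = 0")
    case True
    have "b = 0"
    proof (rule ccontr)
      assume "b \<noteq> 0"
      \<comment> \<open>With \<open>c = 0\<close> the form is affine in \<open>t\<close>, and this
        \<open>t\<close> gives it the value \<open>a - (a + 1) = -1\<close>.\<close>
      then show False using quad[of 1 "(a + 1) / (2 * b)"] True by simp
    qed
    then show ?thesis using True by simp
  next
    case False
    then have c: "c > 0" by (simp add: c_def)
    have "0 \<le> c\<^sup>2 * a - 2 * (c * b) * b + b\<^sup>2 * c" by (rule quad)
    also have "\<dots> = c * (a * c - b\<^sup>2)" by (simp add: power2_eq_square algebra_simps)
    finally show ?thesis using c by (simp add: zero_le_mult_iff)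
  qed
  then have "b \<le> L2_norm f * L2_norm g"
    unfolding a_def c_def power_mult_distrib[symmetric]
    by (rule power2_le_imp_le) (simp add: L2_norm_nonneg)
  with le_b show ?thesis by simp
qed

lemma L2_inner_sum_left:
  assumes "\<And>i. i \<in> I \<Longrightarrow> e i \<in> L2" "g \<in> L2"
  shows "L2_inner (\<lambda>x. \<Sum>i\<in>I. c i * e i x) g = (\<Sum>i\<in>I. c i * L2_inner (e i) g)"
proof -
  have "L2_inner (\<lambda>x. \<Sum>i\<in>I. c i * e i x) g = (LINT x|lebesgue. (\<Sum>i\<in>I. c i * (e i x * cnj (g x))))"
    unfolding L2_inner_def by (simp add: sum_distrib_right mult.assoc)
  also have "\<dots> = (\<Sum>i\<in>I. LINT x|lebesgue. c i * (e i x * cnj (g x)))"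
    using assms by (intro Bochner_Integration.integral_sum integrable_mult_right L2_inner_integrable)
  finally show ?thesis by (simp add: L2_inner_def)
qed

lemma L2_inner_commute: "L2_inner f g = cnj (L2_inner g f)"
  unfolding L2_inner_def by (subst Bochner_Integration.integral_cnj[symmetric]) (simp add: mult.commute)

lemma L2_inner_self: "L2_inner f f = complex_of_real ((L2_norm f)\<^sup>2)"
  unfolding L2_inner_def L2_norm_square
  by (simp add: complex_norm_square[symmetric] flip: integral_complex_of_real)

text \<open>
  The hypothesis is the upper frame bound for the single function \<open>S = \<Sum> \<langle>f, e i\<rangle> e i\<close>,
  so the bound passes from a subspace containing the \<open>e i\<close> to all of \<open>L\<^sup>2\<close>.
\<close>

lemma Bessel_inequality_extend:
  fixes f :: "real^'n \<Rightarrow> complex"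
  assumes f: "f \<in> L2" and e: "\<And>i. i \<in> F \<Longrightarrow> e i \<in> L2"
    and S: "S = (\<lambda>x. \<Sum>i\<in>F. L2_inner f (e i) * e i x)"
    and bound: "(\<Sum>i\<in>F. (cmod (L2_inner S (e i)))\<^sup>2) \<le> (L2_norm S)\<^sup>2"
  shows "(\<Sum>i\<in>F. (cmod (L2_inner f (e i)))\<^sup>2) \<le> (L2_norm f)\<^sup>2"
proof -
  define Q where "Q = (\<Sum>i\<in>F. (cmod (L2_inner f (e i)))\<^sup>2)"
  have Q0: "0 \<le> Q" unfolding Q_def by (intro sum_nonneg) auto
  have SL2: "S \<in> L2" unfolding S by (intro L2_sum L2_scale e)
  \<comment> \<open>Pairing \<open>S\<close> with \<open>f\<close> gives \<open>Q\<close>, hence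
    \<open>Q \<le> L2_norm S * L2_norm f\<close>. Pairing \<open>S\<close> with itself and using
    \<open>bound\<close> gives \<open>L2_norm S \<le> sqrt Q\<close>. Together they yield
    \<open>sqrt Q \<le> L2_norm f\<close>.\<close>
  have "L2_inner S f = (\<Sum>i\<in>F. L2_inner f (e i) * L2_inner (e i) f)"
    unfolding S by (rule L2_inner_sum_left[OF e f])
  also have "\<dots> = complex_of_real Q"
    by (subst L2_inner_commute[of _ f]) (simp add: Q_def complex_norm_square[symmetric])
  finally have Q_le: "Q \<le> L2_norm S * L2_norm f"
    using L2_Cauchy_Schwarz[OF SL2 f] Q0 by simp
  have "complex_of_real ((L2_norm S)\<^sup>2) = L2_inner S S" by (simp add: L2_inner_self)
  also have "\<dots> = (\<Sum>i\<in>F. L2_inner f (e i) * L2_inner (e i) S)"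
    by (subst (1) S) (rule L2_inner_sum_left[OF e SL2])
  also have "cmod \<dots> \<le> (\<Sum>i\<in>F. cmod (L2_inner f (e i)) * cmod (L2_inner S (e i)))"
    by (rule order_trans[OF norm_sum]) (subst L2_inner_commute[of _ S], simp add: norm_mult)
  also have "\<dots> \<le> sqrt Q * sqrt (\<Sum>i\<in>F. (cmod (L2_inner S (e i)))\<^sup>2)"
    using L2_set_mult_ineq[of "\<lambda>i. cmod (L2_inner f (e i))" "\<lambda>i. cmod (L2_inner S (e i))" F]
    by (simp add: L2_set_def Q_def)
  also have "\<dots> \<le> sqrt Q * L2_norm S"
    using bound Q0 by (intro mult_left_mono real_le_lsqrt) (auto simp: L2_norm_nonneg intro: sum_nonneg)
  finally have "L2_norm S * L2_norm S \<le> sqrt Q * L2_norm S"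
    by (simp add: norm_power power2_eq_square norm_mult)
  then have "L2_norm S \<le> sqrt Q"
    using L2_norm_nonneg[of S] Q0 by (cases "L2_norm S = 0") auto
  then have "sqrt Q * sqrt Q \<le> sqrt Q * L2_norm f"
    using Q_le Q0 L2_norm_nonneg[of f] by (simp flip: real_sqrt_mult) (meson mult_right_mono order_trans)
  then have "sqrt Q \<le> L2_norm f"
    using L2_norm_nonneg[of f] Q0 mult_left_le_imp_le[of "sqrt Q" "sqrt Q" "L2_norm f"]
    by (cases "Q = 0") auto
  then have "(sqrt Q)\<^sup>2 \<le> (L2_norm f)\<^sup>2" using Q0 by (intro power_mono) auto
  then show ?thesis using Q0 by (simp add: Q_def)
qed

section \<open>Affine substitution and null sequences in L^2\<close>

lemma L2_affine:
  fixes M :: "real^'n \<Rightarrow> real^'n"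
  assumes "linear M" "det (matrix M) \<noteq> 0" "f \<in> L2"
  shows "(\<lambda>x. f (M x + t)) \<in> L2"
    and "(L2_norm (\<lambda>x. f (M x + t)))\<^sup>2 = (L2_norm f)\<^sup>2 / \<bar>det (matrix M)\<bar>"
proof -
  note [measurable] = L2_measurable[OF assms(3)]
  have m: "(\<lambda>x. (cmod (f x))\<^sup>2) \<in> borel_measurable lebesgue" by measurable
  show "(\<lambda>x. f (M x + t)) \<in> L2"
    unfolding L2_def
    using measurable_lebesgue_affine[OF assms(1,2) L2_measurable[OF assms(3)]]
      integrable_lebesgue_affine[OF assms(1,2) m L2_integrable[OF assms(3)]] by simp
  show "(L2_norm (\<lambda>x. f (M x + t)))\<^sup>2 = (L2_norm f)\<^sup>2 / \<bar>det (matrix M)\<bar>"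
    unfolding L2_norm_square using integral_lebesgue_affine[OF assms(1,2) m] by simp
qed

lemma L2_norm_scale_square: "(L2_norm (\<lambda>x. c * f x))\<^sup>2 = (cmod c)\<^sup>2 * (L2_norm f)\<^sup>2"
  by (simp add: L2_norm_square norm_mult power_mult_distrib)

lemma tendsto_zero_squareD: "(\<lambda>n. (f n :: real)) \<longlonglongrightarrow> 0 \<Longrightarrow> (\<lambda>n. (f n)\<^sup>2) \<longlonglongrightarrow> 0"
  using tendsto_power[of f 0 sequentially 2] by simp

lemma tendsto_zero_squareI: "(\<lambda>n. (f n :: real)\<^sup>2) \<longlonglongrightarrow> 0 \<Longrightarrow> f \<longlonglongrightarrow> 0"
  using tendsto_real_sqrt[of "\<lambda>n. (f n)\<^sup>2" 0 sequentially] by (simp add: tendsto_rabs_zero_iff)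

lemma L2_norm_add_tendsto_zero:
  assumes "\<And>n. u n \<in> L2" "\<And>n. v n \<in> L2"
    and "(\<lambda>n. L2_norm (u n)) \<longlonglongrightarrow> 0" "(\<lambda>n. L2_norm (v n)) \<longlonglongrightarrow> 0"
  shows "(\<lambda>n. L2_norm (\<lambda>x. u n x + v n x)) \<longlonglongrightarrow> 0"
proof (rule tendsto_zero_squareI, rule tendsto_sandwich[of "\<lambda>_. 0"])
  have "(\<lambda>n. 2 * (L2_norm (u n))\<^sup>2 + 2 * (L2_norm (v n))\<^sup>2) \<longlonglongrightarrow> 2 * 0\<^sup>2 + 2 * 0\<^sup>2"
    using assms(3,4) by (intro tendsto_intros)
  then show "(\<lambda>n. 2 * (L2_norm (u n))\<^sup>2 + 2 * (L2_norm (v n))\<^sup>2) \<longlonglongrightarrow> 0" by simp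
qed (auto intro!: always_eventually L2_norm_add_square_le assms)

section \<open>The Fourier transform\<close>

lemma fourier_integrable:
  fixes f :: "real^'n \<Rightarrow> complex"
  assumes "integrable lebesgue f"
  shows "integrable lebesgue (\<lambda>x. f x * exp (- (2 * complex_of_real pi * \<i> * complex_of_real (x \<bullet> \<xi>))))"
proof -
  have "(\<lambda>x::real^'n. exp (- (2 * complex_of_real pi * \<i> * complex_of_real (x \<bullet> \<xi>)))) \<in> borel_measurable borel"
    by (intro borel_measurable_continuous_onI continuous_intros)
  then have [measurable]: "(\<lambda>x::real^'n. exp (- (2 * complex_of_real pi * \<i> * complex_of_real (x \<bullet> \<xi>)))) \<in> borel_measurable lebesgue"
    by (intro measurable_completion) simp
  have [measurable]: "f \<in> borel_measurable lebesgue" using assms by auto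
  show ?thesis
    by (rule Bochner_Integration.integrable_bound[OF assms]) (auto simp: norm_mult)
qed

lemma fourier_add:
  assumes "integrable lebesgue f" "integrable lebesgue g"
  shows "fourier (\<lambda>x. f x + g x) \<xi> = fourier f \<xi> + fourier g \<xi>"
  unfolding fourier_def using assms[THEN fourier_integrable]
  by (simp add: distrib_right)

lemma fourier_scale: "fourier (\<lambda>x. c * f x) \<xi> = c * fourier f \<xi>"
  unfolding fourier_def by (simp add: mult.assoc)

lemma is_L2_fourier_L2: "is_L2_fourier f g \<Longrightarrow> f \<in> L2" "is_L2_fourier f g \<Longrightarrow> g \<in> L2"
  by (auto simp: is_L2_fourier_def)

lemma is_L2_fourierE:
  assumes "is_L2_fourier f g"
  obtains u where "\<And>n. integrable lebesgue (u n)" "\<And>n::nat. u n \<in> L2" "\<And>n. fourier (u n) \<in> L2"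
    "(\<lambda>n. L2_norm (\<lambda>x. u n x - f x)) \<longlonglongrightarrow> 0" "(\<lambda>n. L2_norm (\<lambda>\<xi>. fourier (u n) \<xi> - g \<xi>)) \<longlonglongrightarrow> 0"
  using assms unfolding is_L2_fourier_def by blast

lemma is_L2_fourier_add:
  assumes "is_L2_fourier f g" "is_L2_fourier f' g'"
  shows "is_L2_fourier (\<lambda>x. f x + f' x) (\<lambda>x. g x + g' x)"
proof -
  note L2 = assms[THEN is_L2_fourier_L2(1)] assms[THEN is_L2_fourier_L2(2)]
  obtain u where u: "\<And>n. integrable lebesgue (u n)" "\<And>n::nat. u n \<in> L2" "\<And>n. fourier (u n) \<in> L2"
    "(\<lambda>n. L2_norm (\<lambda>x. u n x - f x)) \<longlonglongrightarrow> 0" "(\<lambda>n. L2_norm (\<lambda>\<xi>. fourier (u n) \<xi> - g \<xi>)) \<longlonglongrightarrow> 0"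
    by (rule is_L2_fourierE[OF assms(1)]) (rule that)
  obtain v where v: "\<And>n. integrable lebesgue (v n)" "\<And>n::nat. v n \<in> L2" "\<And>n. fourier (v n) \<in> L2"
    "(\<lambda>n. L2_norm (\<lambda>x. v n x - f' x)) \<longlonglongrightarrow> 0" "(\<lambda>n. L2_norm (\<lambda>\<xi>. fourier (v n) \<xi> - g' \<xi>)) \<longlonglongrightarrow> 0"
    by (rule is_L2_fourierE[OF assms(2)]) (rule that)
  have F: "fourier (\<lambda>x. u n x + v n x) = (\<lambda>\<xi>. fourier (u n) \<xi> + fourier (v n) \<xi>)" for n
    using u v by (auto simp: fourier_add)
  have "(\<lambda>n. L2_norm (\<lambda>x. (u n x - f x) + (v n x - f' x))) \<longlonglongrightarrow> 0"
    "(\<lambda>n. L2_norm (\<lambda>\<xi>. (fourier (u n) \<xi> - g \<xi>) + (fourier (v n) \<xi> - g' \<xi>))) \<longlonglongrightarrow> 0"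
    by (intro L2_norm_add_tendsto_zero u v L2_diff L2)+
  then show ?thesis
    unfolding is_L2_fourier_def using u v L2
    by (intro conjI exI[of _ "\<lambda>n x. u n x + v n x"]) (auto simp: F L2_add add_diff_add)
qed

lemma is_L2_fourier_scale:
  assumes "is_L2_fourier f g"
  shows "is_L2_fourier (\<lambda>x. c * f x) (\<lambda>x. c * g x)"
proof -
  obtain u where u: "\<And>n. integrable lebesgue (u n)" "\<And>n::nat. u n \<in> L2" "\<And>n. fourier (u n) \<in> L2"
    "(\<lambda>n. L2_norm (\<lambda>x. u n x - f x)) \<longlonglongrightarrow> 0" "(\<lambda>n. L2_norm (\<lambda>\<xi>. fourier (u n) \<xi> - g \<xi>)) \<longlonglongrightarrow> 0"
    by (rule is_L2_fourierE[OF assms]) (rule that)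
  have F: "fourier (\<lambda>x. c * u n x) = (\<lambda>\<xi>. c * fourier (u n) \<xi>)" for n
    by (auto simp: fourier_scale)
  have lim: "(\<lambda>n. L2_norm (\<lambda>x. c * w n x)) \<longlonglongrightarrow> 0" if "(\<lambda>n. L2_norm (w n)) \<longlonglongrightarrow> 0"
    for w :: "nat \<Rightarrow> real^'a \<Rightarrow> complex"
    by (rule tendsto_zero_squareI, unfold L2_norm_scale_square)
      (rule tendsto_mult_right_zero[OF tendsto_zero_squareD[OF that]])
  show ?thesis
    unfolding is_L2_fourier_def using u lim[OF u(4)] lim[OF u(5)] is_L2_fourier_L2[OF assms]
    by (intro conjI exI[of _ "\<lambda>n x. c * u n x"]) (auto simp: F L2_scale right_diff_distrib)
qed

text \<open>By \<open>adj\<close>, \<open>M'\<close> is the inverse of the adjoint of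
  \<open>M\<close>. For the integrable approximants the formula is a substitution in the integral;
  it survives the limit because composition with \<open>M\<close> or \<open>M'\<close> only rescales
  L^2 norms.\<close>

lemma is_L2_fourier_dilate:
  fixes M M' :: "real^'n \<Rightarrow> real^'n"
  assumes M: "linear M" "det (matrix M) \<noteq> 0" "linear M'" "det (matrix M') \<noteq> 0"
    and adj: "\<And>x \<xi>. M x \<bullet> M' \<xi> = x \<bullet> \<xi>"
    and fg: "is_L2_fourier f g"
  shows "is_L2_fourier (\<lambda>x. f (M x)) (\<lambda>\<xi>. complex_of_real (1 / \<bar>det (matrix M)\<bar>) * g (M' \<xi>))"
proof -
  let ?c = "complex_of_real (1 / \<bar>det (matrix M)\<bar>)"
  note aff = L2_affine[OF M(1,2), of _ 0, simplified] and aff' = L2_affine[OF M(3,4), of _ 0, simplified]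
  obtain u where u: "\<And>n. integrable lebesgue (u n)" "\<And>n::nat. u n \<in> L2" "\<And>n. fourier (u n) \<in> L2"
    "(\<lambda>n. L2_norm (\<lambda>x. u n x - f x)) \<longlonglongrightarrow> 0" "(\<lambda>n. L2_norm (\<lambda>\<xi>. fourier (u n) \<xi> - g \<xi>)) \<longlonglongrightarrow> 0"
    by (rule is_L2_fourierE[OF fg]) (rule that)
  note L2 = is_L2_fourier_L2[OF fg]
  have F: "fourier (\<lambda>x. u n (M x)) = (\<lambda>\<xi>. ?c * fourier (u n) (M' \<xi>))" for n
  proof
    fix \<xi>
    show "fourier (\<lambda>x. u n (M x)) \<xi> = ?c * fourier (u n) (M' \<xi>)"
      using integral_lebesgue_affine[OF M(1,2) borel_measurable_integrable[OF
            fourier_integrable[OF u(1)[of n], of "M' \<xi>"]], of 0]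
      unfolding fourier_def by (simp add: adj scaleR_conv_of_real)
  qed
  have 1: "(\<lambda>n. L2_norm (\<lambda>x. u n (M x) - f (M x))) \<longlonglongrightarrow> 0"
    by (rule tendsto_zero_squareI, unfold aff(2)[OF L2_diff[OF u(2) L2(1)]])
      (rule tendsto_divide_zero[OF tendsto_zero_squareD[OF u(4)]])
  have 2: "(\<lambda>n. L2_norm (\<lambda>\<xi>. fourier (\<lambda>x. u n (M x)) \<xi> - ?c * g (M' \<xi>))) \<longlonglongrightarrow> 0"
    by (rule tendsto_zero_squareI, unfold F right_diff_distrib[symmetric] L2_norm_scale_square
        aff'(2)[OF L2_diff[OF u(3) L2(2)]])
      (rule tendsto_mult_right_zero[OF tendsto_divide_zero[OF tendsto_zero_squareD[OF u(5)]]])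
  have 3: "integrable lebesgue (\<lambda>x. u n (M x))" for n
    using integrable_lebesgue_affine[OF M(1,2) borel_measurable_integrable u(1), of n 0] u(1) by simp
  have 4: "(\<lambda>\<xi>. ?c * h (M' \<xi>)) \<in> L2" if "h \<in> L2" for h
    using that by (rule L2_scale[OF aff'(1)])
  show ?thesis
    unfolding is_L2_fourier_def
    by (intro conjI exI[of _ "\<lambda>n x. u n (M x)"] allI 1 2 3 aff(1) L2 u 4)
      (unfold F, rule 4, rule u)
qed

section \<open>The space \<open>H2 G\<close> and the upper frame bound\<close>

lemma H2_L2: "f \<in> H2 G \<Longrightarrow> f \<in> L2"
  by (simp add: H2_def)

lemma H2_zero: "(\<lambda>x::real^'n. 0) \<in> H2 G"
proof -
  have "fourier (\<lambda>x::real^'n. 0) = (\<lambda>\<xi>. 0)" by (simp add: fourier_def fun_eq_iff)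
  then have "is_L2_fourier (\<lambda>x::real^'n. 0) (\<lambda>x. 0)"
    unfolding is_L2_fourier_def by (intro conjI exI[of _ "\<lambda>n x. 0"]) (auto simp: L2_zero L2_norm_def)
  then show ?thesis by (auto simp: H2_def L2_zero)
qed

lemma H2_add: "f \<in> H2 G \<Longrightarrow> f' \<in> H2 G \<Longrightarrow> (\<lambda>x. f x + f' x) \<in> H2 G"
proof -
  assume "f \<in> H2 G" "f' \<in> H2 G"
  then obtain g g' where g: "is_L2_fourier f g" "AE \<xi> in lebesgue. g \<xi> \<noteq> 0 \<longrightarrow> \<xi> \<in> G"
    and g': "is_L2_fourier f' g'" "AE \<xi> in lebesgue. g' \<xi> \<noteq> 0 \<longrightarrow> \<xi> \<in> G"
    by (auto simp: H2_def)
  have "AE \<xi> in lebesgue. g \<xi> + g' \<xi> \<noteq> 0 \<longrightarrow> \<xi> \<in> G"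
    using g(2) g'(2) by eventually_elim auto
  with is_L2_fourier_add[OF g(1) g'(1)] show ?thesis
    unfolding H2_def by (auto dest: is_L2_fourier_L2)
qed

lemma H2_scale: "f \<in> H2 G \<Longrightarrow> (\<lambda>x. c * f x) \<in> H2 G"
  unfolding H2_def using is_L2_fourier_scale[of f _ c]
  by (fastforce intro: L2_scale elim: eventually_mono)

lemma H2_sum: "(\<And>i. i \<in> I \<Longrightarrow> f i \<in> H2 G) \<Longrightarrow> (\<lambda>x. \<Sum>i\<in>I. f i x) \<in> H2 G"
  by (induction I rule: infinite_finite_induct) (auto intro: H2_zero H2_add)

text \<open>Stated for all of \<open>L2\<close> because it will be applied to Gaussians. The finite
  sum \<open>S\<close> is a combination of frame elements, so it lies in \<open>H2 G\<close> and the
  frame identity holds for it; \<open>Bessel_inequality_extend\<close> then returns from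
  \<open>S\<close> to \<open>f\<close>.\<close>

lemma tight_frame_Bessel:
  assumes frame: "tight_frame_multiwavelet A G N \<psi>" and f: "f \<in> L2"
    and F: "finite F" "F \<subseteq> {1..N} \<times> UNIV \<times> int_lattice"
  shows "(\<Sum>(\<alpha>, j, k)\<in>F. (cmod (L2_inner f (wavelet_elem A (\<psi> \<alpha>) j k)))\<^sup>2) \<le> (L2_norm f)\<^sup>2"
proof -
  define e where "e = (\<lambda>(\<alpha>, j, k). wavelet_elem A (\<psi> \<alpha>) j k)"
  define S where "S = (\<lambda>x. \<Sum>i\<in>F. L2_inner f (e i) * e i x)"
  have eH: "e i \<in> H2 G" if "i \<in> F" for i
  proof -
    obtain \<alpha> j k where i: "i = (\<alpha>, j, k)" by (cases i)
    then have "e i = wavelet_elem A (\<psi> \<alpha>) j k" "\<alpha> \<in> {1..N}" "k \<in> int_lattice"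
      using that F(2) by (auto simp: e_def)
    then have "e i \<in> affine_system A N \<psi>" unfolding affine_system_def by blast
    then show ?thesis using frame unfolding tight_frame_multiwavelet_def by blast
  qed
  have SH: "S \<in> H2 G" unfolding S_def by (intro H2_sum H2_scale eH)
  have "((\<lambda>i. (cmod (L2_inner S (e i)))\<^sup>2) has_sum (L2_norm S)\<^sup>2) ({1..N} \<times> UNIV \<times> int_lattice)"
    using frame SH unfolding tight_frame_multiwavelet_def e_def by (simp add: case_prod_unfold)
  then have "(\<Sum>i\<in>F. (cmod (L2_inner S (e i)))\<^sup>2) \<le> (L2_norm S)\<^sup>2"
    by (rule finite_sum_le_has_sum) (use F in auto)
  from Bessel_inequality_extend[OF f H2_L2[OF eH] S_def this]
  show ?thesis by (simp add: e_def case_prod_unfold)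
qed

section \<open>Gaussian integrals\<close>

text \<open>Fubini in coordinates: \<open>lborel_eq\<close> presents \<open>lborel\<close> as the
  image under \<open>?T\<close> of a product of copies of the line, on which a product integrand
  factors.\<close>

lemma
  fixes f :: "'a::euclidean_space \<Rightarrow> real \<Rightarrow> 'b::{real_normed_field, banach, second_countable_topology}"
  assumes int: "\<And>b. b \<in> Basis \<Longrightarrow> integrable lborel (f b)"
  shows integrable_lborel_coordinates: "integrable lborel (\<lambda>x. \<Prod>b\<in>Basis. f b (x \<bullet> b))"
    and integral_lborel_coordinates:
      "(LINT x|lborel. (\<Prod>b\<in>Basis. f b (x \<bullet> b))) = (\<Prod>b\<in>Basis. LINT t|lborel. f b t)"
proof -
  interpret product_sigma_finite "\<lambda>b::'a. lborel :: real measure"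
    by standard
  let ?T = "\<lambda>v. \<Sum>b\<in>Basis. v b *\<^sub>R b :: 'a"
  have [measurable]: "f b \<in> borel_measurable borel" if "b \<in> Basis" for b
    using int[OF that] by auto
  have T: "?T v \<bullet> b = v b" if "b \<in> Basis" for v b
    using that by (simp add: inner_sum_left inner_Basis if_distrib cong: if_cong)
  have F: "(\<lambda>x. \<Prod>b\<in>Basis. f b (x \<bullet> b)) \<in> borel_measurable borel" by measurable
  have Tm: "?T \<in> measurable (Pi\<^sub>M Basis (\<lambda>b. lborel)) borel" by measurable
  have "integrable (Pi\<^sub>M Basis (\<lambda>b. lborel)) (\<lambda>v. \<Prod>b\<in>Basis. f b (v b))"
    by (rule product_integrable_prod) (use int in auto)
  then show "integrable lborel (\<lambda>x. \<Prod>b\<in>Basis. f b (x \<bullet> b))"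
    by (subst lborel_eq, subst integrable_distr_eq[OF Tm F]) (simp add: T)
  show "(LINT x|lborel. (\<Prod>b\<in>Basis. f b (x \<bullet> b))) = (\<Prod>b\<in>Basis. LINT t|lborel. f b t)"
    by (subst lborel_eq, subst integral_distr[OF Tm F]) (simp add: T product_integral_prod int)
qed

text \<open>Up to the factor \<open>sqrt (2 * pi)\<close> this is the characteristic function of the
  standard normal distribution at \<open>- 2 * pi * s\<close>.\<close>

lemma
  fixes s :: real
  shows integrable_gaussian_phase:
      "integrable lborel (\<lambda>t. complex_of_real (exp (- t\<^sup>2 / 2)) * exp (- (2 * complex_of_real pi * \<i> * complex_of_real (s * t))))"
    and integral_gaussian_phase:
      "(LINT t|lborel. complex_of_real (exp (- t\<^sup>2 / 2)) * exp (- (2 * complex_of_real pi * \<i> * complex_of_real (s * t)))) =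
        complex_of_real (sqrt (2 * pi) * exp (- (2 * pi\<^sup>2 * s\<^sup>2)))"
proof -
  let ?F = "\<lambda>t. complex_of_real (exp (- t\<^sup>2 / 2)) * exp (- (2 * complex_of_real pi * \<i> * complex_of_real (s * t)))"
  have F: "?F t = complex_of_real (sqrt (2 * pi)) * (std_normal_density t *\<^sub>R iexp ((- 2 * pi * s) * t))" for t
    by (simp add: std_normal_density_def scaleR_conv_of_real mult.assoc)
      (simp add: algebra_simps)
  have int: "integrable lborel (\<lambda>t. std_normal_density t *\<^sub>R iexp ((- 2 * pi * s) * t))"
    by (rule Bochner_Integration.integrable_bound[OF integrable_normal_density[of 1 0]]) (auto simp: abs_mult)
  show "integrable lborel ?F" unfolding F by (intro integrable_mult_right int)
  have "char std_normal_distribution (- 2 * pi * s) = (LINT t|lborel. std_normal_density t *\<^sub>R iexp ((- 2 * pi * s) * t))"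
    unfolding char_def by (subst integral_density) auto
  moreover have "char std_normal_distribution (- 2 * pi * s) = complex_of_real (exp (- (2 * pi\<^sup>2 * s\<^sup>2)))"
    by (simp add: char_std_normal_distribution power_mult_distrib)
  ultimately show "(LINT t|lborel. ?F t) = complex_of_real (sqrt (2 * pi) * exp (- (2 * pi\<^sup>2 * s\<^sup>2)))"
    unfolding F by (subst integral_mult_right_zero) simp
qed

lemma norm_square_coordinates: "(norm x)\<^sup>2 = (\<Sum>b\<in>Basis. (x \<bullet> b)\<^sup>2)"
  for x :: "'a::euclidean_space"
  unfolding power2_norm_eq_inner by (subst euclidean_inner) (simp add: power2_eq_square)

lemma
  fixes x :: "'a::euclidean_space"
  shows integrable_gaussian_phase_euclidean:
      "integrable lborel (\<lambda>t. complex_of_real (exp (- (norm t)\<^sup>2 / 2)) * exp (- (2 * complex_of_real pi * \<i> * complex_of_real (x \<bullet> t))))"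
    and integral_gaussian_phase_euclidean:
      "(LINT t|lborel. complex_of_real (exp (- (norm t)\<^sup>2 / 2)) * exp (- (2 * complex_of_real pi * \<i> * complex_of_real (x \<bullet> t)))) =
        complex_of_real (sqrt (2 * pi) ^ DIM('a) * exp (- (2 * pi\<^sup>2 * (norm x)\<^sup>2)))"
proof -
  let ?F = "\<lambda>t::'a. complex_of_real (exp (- (norm t)\<^sup>2 / 2)) * exp (- (2 * complex_of_real pi * \<i> * complex_of_real (x \<bullet> t)))"
  let ?f = "\<lambda>(b::'a) t. complex_of_real (exp (- t\<^sup>2 / 2)) * exp (- (2 * complex_of_real pi * \<i> * complex_of_real ((x \<bullet> b) * t)))"
  have F: "?F = (\<lambda>t. \<Prod>b\<in>Basis. ?f b (t \<bullet> b))"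
  proof
    fix t :: 'a
    have "complex_of_real (exp (- (norm t)\<^sup>2 / 2)) = (\<Prod>b\<in>Basis. complex_of_real (exp (- (t \<bullet> b)\<^sup>2 / 2)))"
      by (simp add: norm_square_coordinates exp_sum[symmetric] sum_divide_distrib sum_negf flip: of_real_prod)
    moreover have "exp (- (2 * complex_of_real pi * \<i> * complex_of_real (x \<bullet> t))) =
        (\<Prod>b\<in>Basis. exp (- (2 * complex_of_real pi * \<i> * complex_of_real ((x \<bullet> b) * (t \<bullet> b)))))"
      by (subst euclidean_inner) (simp add: exp_sum[symmetric] sum_distrib_left sum_negf)
    ultimately show "?F t = (\<Prod>b\<in>Basis. ?f b (t \<bullet> b))" by (simp add: prod.distrib)
  qed
  show "integrable lborel ?F"
    unfolding F by (rule integrable_lborel_coordinates) (rule integrable_gaussian_phase)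
  have "(LINT t|lborel. ?F t) = (\<Prod>b\<in>(Basis::'a set). complex_of_real (sqrt (2 * pi) * exp (- (2 * pi\<^sup>2 * (x \<bullet> b)\<^sup>2))))"
    unfolding F by (subst integral_lborel_coordinates[OF integrable_gaussian_phase]) (simp only: integral_gaussian_phase)
  also have "\<dots> = complex_of_real (sqrt (2 * pi) ^ DIM('a) * exp (- (2 * pi\<^sup>2 * (norm x)\<^sup>2)))"
    by (simp add: norm_square_coordinates prod.distrib exp_sum[symmetric] sum_distrib_left sum_negf
        flip: of_real_prod of_real_mult of_real_power)
  finally show "(LINT t|lborel. ?F t) = complex_of_real (sqrt (2 * pi) ^ DIM('a) * exp (- (2 * pi\<^sup>2 * (norm x)\<^sup>2)))" .
qed

lemma integrable_gaussian:
  fixes c :: real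
  assumes "c > 0"
  shows "integrable lborel (\<lambda>x::'a::euclidean_space. exp (- c * (norm x)\<^sup>2))"
proof -
  have 0: "exp (- (2 * complex_of_real pi * \<i> * complex_of_real ((0::'a) \<bullet> t))) = 1" for t by simp
  have "integrable lborel (\<lambda>x::'a. complex_of_real (exp (- (norm x)\<^sup>2 / 2)))"
    using integrable_gaussian_phase_euclidean[of "0::'a"] unfolding 0 by simp
  then have 1: "integrable lborel (\<lambda>x::'a. exp (- (norm x)\<^sup>2 / 2))"
    unfolding complex_of_real_integrable_eq .
  \<comment> \<open>The rate 1/2 comes from the phase integral at frequency 0. Scaling by this
    \<open>a\<close> turns the rate 1/2 into \<open>c\<close>.\<close>
  define a where "a = sqrt (2 * c)"
  have a: "a > 0" "a\<^sup>2 = 2 * c" using assms by (auto simp: a_def)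
  have "lborel = density (distr lborel borel (\<lambda>x::'a. a *\<^sub>R x)) (\<lambda>_. \<bar>a\<bar>^DIM('a))"
    using lborel_affine[of a "0::'a"] a by simp
  with 1 have "integrable (density (distr lborel borel (\<lambda>x::'a. a *\<^sub>R x)) (\<lambda>_. \<bar>a\<bar>^DIM('a)))
      (\<lambda>x::'a. exp (- (norm x)\<^sup>2 / 2))" by simp
  then have "integrable (distr lborel borel (\<lambda>x::'a. a *\<^sub>R x)) (\<lambda>x::'a. \<bar>a\<bar>^DIM('a) * exp (- (norm x)\<^sup>2 / 2))"
    by (subst (asm) integrable_density) auto
  then have "integrable (distr lborel borel (\<lambda>x::'a. a *\<^sub>R x)) (\<lambda>x::'a. exp (- (norm x)\<^sup>2 / 2))"
    using a by simp
  then have "integrable lborel (\<lambda>x::'a. exp (- (norm (a *\<^sub>R x))\<^sup>2 / 2))"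
    by (subst (asm) integrable_distr_eq) auto
  then show ?thesis using a by (simp add: power_mult_distrib)
qed

text \<open>Complete the square about the midpoint \<open>?m\<close>: the product is a Gaussian
  centred there, times a factor depending on \<open>a - b\<close> only, whose rate is half of the
  original. This factor is the same as in \<open>integral_gaussian_phase_euclidean\<close>, which
  makes the two Gram kernels proportional.\<close>

lemma autocorrelation_gaussian:
  fixes a b :: "'a::euclidean_space"
  shows "(LINT t|lborel. exp (- (4 * pi\<^sup>2 * (norm (t - a))\<^sup>2)) * exp (- (4 * pi\<^sup>2 * (norm (t - b))\<^sup>2))) =
    exp (- (2 * pi\<^sup>2 * (norm (a - b))\<^sup>2)) * (LINT t|lborel. exp (- (8 * pi\<^sup>2 * (norm (t::'a))\<^sup>2)))"
proof -
  let ?m = "(1/2) *\<^sub>R (a + b)"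
  have sq: "4 * pi\<^sup>2 * (norm (t - a))\<^sup>2 + 4 * pi\<^sup>2 * (norm (t - b))\<^sup>2 =
      2 * pi\<^sup>2 * (norm (a - b))\<^sup>2 + 8 * pi\<^sup>2 * (norm (t - ?m))\<^sup>2" for t
  proof -
    have "(norm (t - a))\<^sup>2 + (norm (t - b))\<^sup>2 = (norm (a - b))\<^sup>2 / 2 + 2 * (norm (t - ?m))\<^sup>2"
      by (simp add: power2_norm_eq_inner inner_diff_left inner_diff_right inner_add_left inner_add_right
          inner_commute field_simps)
    then have "4 * pi\<^sup>2 * ((norm (t - a))\<^sup>2 + (norm (t - b))\<^sup>2) = 4 * pi\<^sup>2 * ((norm (a - b))\<^sup>2 / 2 + 2 * (norm (t - ?m))\<^sup>2)"
      by simp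
    then show ?thesis by (simp add: algebra_simps)
  qed
  have "(LINT t|lborel. exp (- (4 * pi\<^sup>2 * (norm (t - a))\<^sup>2)) * exp (- (4 * pi\<^sup>2 * (norm (t - b))\<^sup>2))) =
      (LINT t|lborel. exp (- (2 * pi\<^sup>2 * (norm (a - b))\<^sup>2)) * exp (- (8 * pi\<^sup>2 * (norm (t - ?m))\<^sup>2)))"
    by (intro Bochner_Integration.integral_cong refl) (simp only: exp_add[symmetric] minus_add_distrib[symmetric] sq)
  also have "\<dots> = exp (- (2 * pi\<^sup>2 * (norm (a - b))\<^sup>2)) * (LINT t|lborel. exp (- (8 * pi\<^sup>2 * (norm (t - ?m))\<^sup>2)))"
    by simp
  also have "(LINT t|lborel. exp (- (8 * pi\<^sup>2 * (norm (t - ?m))\<^sup>2))) = (LINT t|distr lborel borel ((+) (- ?m)). exp (- (8 * pi\<^sup>2 * (norm t)\<^sup>2)))"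
    by (subst integral_distr) (auto simp: add.commute)
  finally show ?thesis unfolding lborel_distr_plus .
qed

lemma integral_gaussian_pos:
  assumes "c > 0"
  shows "0 < (LINT t|lborel. exp (- (c * (norm (t::'a::euclidean_space))\<^sup>2)))"
proof -
  let ?f = "\<lambda>t::'a. exp (- (c * (norm t)\<^sup>2))"
  have "integrable lborel ?f" using integrable_gaussian[OF assms, where 'a='a] by simp
  moreover have "\<not> (AE t in lborel. ?f t = 0)"
    using ae_filter_eq_bot_iff[of "lborel :: 'a measure"] by (simp add: trivial_limit_def)
  ultimately have "integral\<^sup>L lborel ?f \<noteq> 0"
    by (subst integral_nonneg_eq_0_iff_AE) auto
  then show ?thesis by (simp add: order_less_le)
qed

section \<open>Gram kernels\<close>

lemma
  fixes a :: "'a::euclidean_space \<Rightarrow> complex"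
  assumes "integrable lborel a"
  shows integrable_tensor_cnj: "integrable (lborel \<Otimes>\<^sub>M lborel) (\<lambda>(x, y). a x * cnj (a y))"
    and integral_tensor_cnj:
      "(LINT (x, y)|(lborel \<Otimes>\<^sub>M lborel). a x * cnj (a y)) = complex_of_real ((cmod (LINT x|lborel. a x))\<^sup>2)"
proof -
  have [measurable]: "a \<in> borel_measurable borel" using assms by auto
  have cnj: "integrable lborel (\<lambda>x. cnj (a x))" using assms by simp
  have int: "integrable (lborel \<Otimes>\<^sub>M lborel) (\<lambda>(x, y). a x * cnj (a y))"
  proof (rule lborel_pair.Fubini_integrable)
    show "(\<lambda>(x, y). a x * cnj (a y)) \<in> borel_measurable (lborel \<Otimes>\<^sub>M lborel)" by measurable
    show "integrable lborel (\<lambda>x. LINT y|lborel. norm (case (x, y) of (x, y) \<Rightarrow> a x * cnj (a y)))"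
      using integrable_norm[OF assms] by (simp add: norm_mult)
    show "AE x in lborel. integrable lborel (\<lambda>y. case (x, y) of (x, y) \<Rightarrow> a x * cnj (a y))"
      using cnj by auto
  qed
  then show "integrable (lborel \<Otimes>\<^sub>M lborel) (\<lambda>(x, y). a x * cnj (a y))" .
  have "(LINT (x, y)|(lborel \<Otimes>\<^sub>M lborel). a x * cnj (a y)) = (LINT x|lborel. LINT y|lborel. a x * cnj (a y))"
    using lborel_pair.integral_fst[of "\<lambda>x y. a x * cnj (a y)"] int by simp
  also have "\<dots> = (LINT x|lborel. a x) * cnj (LINT y|lborel. a y)" by simp
  finally show "(LINT (x, y)|(lborel \<Otimes>\<^sub>M lborel). a x * cnj (a y)) = complex_of_real ((cmod (LINT x|lborel. a x))\<^sup>2)"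
    by (simp only: complex_norm_square)
qed

text \<open>Expanding the square and exchanging integrals shows that the L^2 norm of the function
  produced from \<open>u\<close> depends on \<open>K\<close> only through the Gram kernel. Two
  kernels with proportional Gram kernels thus give proportional norms for every integrable
  \<open>u\<close>. The bound \<open>K_le\<close> makes the inner integrals converge, and
  \<open>K_int\<close> makes the triple integral converge absolutely.\<close>

lemma
  fixes K :: "'a::euclidean_space \<Rightarrow> 'a \<Rightarrow> complex"
  assumes K[measurable]: "case_prod K \<in> borel_measurable (borel \<Otimes>\<^sub>M borel)"
    and K_le: "\<And>t x. cmod (K t x) \<le> 1"
    and K_int: "\<And>x. (\<integral>\<^sup>+t. ennreal ((cmod (K t x))\<^sup>2) \<partial>lborel) \<le> ennreal C"
    and u: "integrable lborel u"
  shows integrable_square_kernel: "integrable lborel (\<lambda>t. (cmod (LINT x|lborel. K t x * u x))\<^sup>2)"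
    and integral_square_kernel:
      "complex_of_real (LINT t|lborel. (cmod (LINT x|lborel. K t x * u x))\<^sup>2) =
        (LINT (x, y)|(lborel \<Otimes>\<^sub>M lborel). u x * cnj (u y) * (LINT t|lborel. K t x * cnj (K t y)))"
proof -
  \<comment> \<open>The variable \<open>t\<close> is paired with the couple \<open>(x, y)\<close>,
    so that the exchange of integrals is a single use of Fubini.\<close>
  interpret P: pair_sigma_finite "lborel :: 'a measure" "lborel \<Otimes>\<^sub>M lborel :: ('a \<times> 'a) measure"
    by (intro pair_sigma_finite.intro sigma_finite_lborel) (simp add: lborel_prod sigma_finite_lborel)
  have [measurable]: "u \<in> borel_measurable borel" using u by auto
  let ?F = "\<lambda>t (x, y). K t x * u x * cnj (K t y * u y)"
  have Kt: "integrable lborel (\<lambda>x. K t x * u x)" for t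
    by (rule Bochner_Integration.integrable_bound[OF u])
      (use mult_right_mono[OF K_le] in \<open>auto simp: norm_mult\<close>)
  have Fm: "case_prod ?F \<in> borel_measurable (lborel \<Otimes>\<^sub>M (lborel \<Otimes>\<^sub>M lborel))" by measurable
  \<comment> \<open>A bound independent of \<open>x\<close> and \<open>y\<close>: after integration
    in \<open>t\<close> only a constant times the integrable function
    \<open>norm (u x * cnj (u y))\<close> remains.\<close>
  have KK: "(\<integral>\<^sup>+t. ennreal (cmod (K t x) * cmod (K t y)) \<partial>lborel) \<le> ennreal C + ennreal C" for x y
  proof -
    have "cmod (K t x) * cmod (K t y) \<le> (cmod (K t x))\<^sup>2 + (cmod (K t y))\<^sup>2" for t
    proof -
      have "0 \<le> cmod (K t x) * cmod (K t y)" by simp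
      moreover have "2 * (cmod (K t x) * cmod (K t y)) \<le> (cmod (K t x))\<^sup>2 + (cmod (K t y))\<^sup>2"
        using sum_squares_bound[of "cmod (K t x)" "cmod (K t y)"] by (simp add: mult.assoc)
      ultimately show ?thesis by linarith
    qed
    then have "(\<integral>\<^sup>+t. ennreal (cmod (K t x) * cmod (K t y)) \<partial>lborel)
        \<le> (\<integral>\<^sup>+t. ennreal ((cmod (K t x))\<^sup>2) + ennreal ((cmod (K t y))\<^sup>2) \<partial>lborel)"
      by (intro nn_integral_mono) (simp flip: ennreal_plus)
    also have "\<dots> = (\<integral>\<^sup>+t. ennreal ((cmod (K t x))\<^sup>2) \<partial>lborel) + (\<integral>\<^sup>+t. ennreal ((cmod (K t y))\<^sup>2) \<partial>lborel)"
      by (rule nn_integral_add) measurable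
    also have "\<dots> \<le> ennreal C + ennreal C" by (intro add_mono K_int)
    finally show ?thesis .
  qed
  have Fint: "integrable (lborel \<Otimes>\<^sub>M (lborel \<Otimes>\<^sub>M lborel)) (case_prod ?F)"
  proof (rule integrableI_bounded[OF Fm])
    have "(\<integral>\<^sup>+z. ennreal (norm (case_prod ?F z)) \<partial>(lborel \<Otimes>\<^sub>M (lborel \<Otimes>\<^sub>M lborel))) =
        (\<integral>\<^sup>+p. \<integral>\<^sup>+t. ennreal (norm (case_prod ?F (t, p))) \<partial>lborel \<partial>(lborel \<Otimes>\<^sub>M lborel))"
      by (rule P.nn_integral_snd[symmetric]) (use Fm in measurable)
    also have "\<dots> \<le> (\<integral>\<^sup>+p. (ennreal C + ennreal C) * ennreal (norm (case p of (x, y) \<Rightarrow> u x * cnj (u y))) \<partial>(lborel \<Otimes>\<^sub>M lborel))"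
    proof (rule nn_integral_mono)
      fix p :: "'a \<times> 'a"
      obtain x y where p: "p = (x, y)" by (cases p)
      have "(\<integral>\<^sup>+t. ennreal (norm (case_prod ?F (t, p))) \<partial>lborel) =
          (\<integral>\<^sup>+t. ennreal (cmod (K t x) * cmod (K t y)) * ennreal (norm (u x * cnj (u y))) \<partial>lborel)"
        unfolding p by (intro nn_integral_cong) (simp add: norm_mult mult_ac flip: ennreal_mult)
      also have "\<dots> = (\<integral>\<^sup>+t. ennreal (cmod (K t x) * cmod (K t y)) \<partial>lborel) * ennreal (norm (u x * cnj (u y)))"
        by (rule nn_integral_multc) measurable
      also have "\<dots> \<le> (ennreal C + ennreal C) * ennreal (norm (u x * cnj (u y)))"
        by (intro mult_right_mono KK) auto
      finally show "(\<integral>\<^sup>+t. ennreal (norm (case_prod ?F (t, p))) \<partial>lborel)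
          \<le> (ennreal C + ennreal C) * ennreal (norm (case p of (x, y) \<Rightarrow> u x * cnj (u y)))"
        unfolding p by simp
    qed
    also have "\<dots> = (ennreal C + ennreal C) * (\<integral>\<^sup>+p. ennreal (norm (case p of (x, y) \<Rightarrow> u x * cnj (u y))) \<partial>(lborel \<Otimes>\<^sub>M lborel))"
      by (rule nn_integral_cmult) measurable
    also have "\<dots> < \<infinity>"
      using integrable_tensor_cnj[OF u] unfolding integrable_iff_bounded
      by (simp add: ennreal_mult_less_top)
    finally show "(\<integral>\<^sup>+z. ennreal (norm (case_prod ?F z)) \<partial>(lborel \<Otimes>\<^sub>M (lborel \<Otimes>\<^sub>M lborel))) < \<infinity>" .
  qed
  have inner: "(LINT p|(lborel \<Otimes>\<^sub>M lborel). ?F t p) = complex_of_real ((cmod (LINT x|lborel. K t x * u x))\<^sup>2)" for t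
    by (rule integral_tensor_cnj[OF Kt])
  have "integrable lborel (\<lambda>t. complex_of_real ((cmod (LINT x|lborel. K t x * u x))\<^sup>2))"
    using P.integrable_fst[OF Fint] unfolding inner .
  then show "integrable lborel (\<lambda>t. (cmod (LINT x|lborel. K t x * u x))\<^sup>2)"
    unfolding complex_of_real_integrable_eq .
  have "complex_of_real (LINT t|lborel. (cmod (LINT x|lborel. K t x * u x))\<^sup>2) =
      (LINT t|lborel. LINT p|(lborel \<Otimes>\<^sub>M lborel). ?F t p)"
    unfolding inner by (rule integral_complex_of_real[symmetric])
  also have "\<dots> = (LINT p|(lborel \<Otimes>\<^sub>M lborel). LINT t|lborel. ?F t p)"
    by (rule P.Fubini_integral[OF Fint, symmetric])
  also have "\<dots> = (LINT (x, y)|(lborel \<Otimes>\<^sub>M lborel). u x * cnj (u y) * (LINT t|lborel. K t x * cnj (K t y)))"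
  proof (intro Bochner_Integration.integral_cong refl, clarify)
    fix x y
    have "(LINT t|lborel. K t x * u x * cnj (K t y * u y)) = (LINT t|lborel. u x * cnj (u y) * (K t x * cnj (K t y)))"
      by (simp add: mult_ac)
    then show "(LINT t|lborel. K t x * u x * cnj (K t y * u y)) = u x * cnj (u y) * (LINT t|lborel. K t x * cnj (K t y))"
      by simp
  qed
  finally show "complex_of_real (LINT t|lborel. (cmod (LINT x|lborel. K t x * u x))\<^sup>2) =
      (LINT (x, y)|(lborel \<Otimes>\<^sub>M lborel). u x * cnj (u y) * (LINT t|lborel. K t x * cnj (K t y)))" .
qed

section \<open>Weighted norms of Fourier transforms as norms of Gaussian averages\<close>

text \<open>The iterated integrals below use products of Borel measures, whereas members of
  \<open>L2\<close> are only Lebesgue measurable; a Borel representative bridges the two.\<close>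

lemma lebesgue_borel_representative:
  fixes f :: "'a::euclidean_space \<Rightarrow> complex"
  assumes [measurable]: "f \<in> borel_measurable lebesgue"
  obtains f' where "f' \<in> borel_measurable borel" "AE x in lebesgue. f x = f' x"
proof -
  obtain a where a: "a \<in> borel_measurable lborel" "AE x in lborel. Re (f x) = a x"
    using completion_ex_borel_measurable_real[of "\<lambda>x. Re (f x)" lborel] by auto
  obtain b where b: "b \<in> borel_measurable lborel" "AE x in lborel. Im (f x) = b x"
    using completion_ex_borel_measurable_real[of "\<lambda>x. Im (f x)" lborel] by auto
  note [measurable] = a(1) b(1)
  show thesis
  proof (rule that)
    show "(\<lambda>x. complex_of_real (a x) + \<i> * complex_of_real (b x)) \<in> borel_measurable borel"
      using a(1) b(1) by simp
    have "AE x in lborel. f x = complex_of_real (a x) + \<i> * complex_of_real (b x)"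
      using a(2) b(2) by eventually_elim (metis complex_eq)
    then show "AE x in lebesgue. f x = complex_of_real (a x) + \<i> * complex_of_real (b x)"
      by (rule AE_completion)
  qed
qed

lemma
  assumes "AE x in lebesgue. f x = f' x" "f \<in> L2" "f' \<in> borel_measurable borel"
  shows L2_cong_AE: "f' \<in> L2" and L2_inner_cong_AE: "g \<in> L2 \<Longrightarrow> L2_inner f g = L2_inner f' g"
proof -
  have [measurable]: "f' \<in> borel_measurable lebesgue" using assms(3) by (intro measurable_completion) simp
  note [measurable] = L2_measurable[OF assms(2)]
  have "(\<integral>\<^sup>+x. ennreal ((cmod (f x))\<^sup>2) \<partial>lebesgue) = (\<integral>\<^sup>+x. ennreal ((cmod (f' x))\<^sup>2) \<partial>lebesgue)"
    by (rule nn_integral_cong_AE) (use assms(1) in eventually_elim, simp)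
  then show f': "f' \<in> L2" using assms(2) by (simp add: L2_iff_nn_integral)
  assume g: "g \<in> L2"
  note [measurable] = L2_measurable[OF g]
  show "L2_inner f g = L2_inner f' g"
    unfolding L2_inner_def
    by (rule integral_cong_AE) (measurable, measurable, use assms(1) in eventually_elim, simp)
qed

text \<open>The rate is chosen so that the autocorrelation, which halves it, has rate
  \<open>2 * pi\<^sup>2\<close>. That is the rate of the Fourier transform of
  \<open>exp (- (norm t)\<^sup>2 / 2)\<close> in the normalisation of \<open>fourier\<close>. The
  first argument is the centre.\<close>

definition gauss :: "real^'n \<Rightarrow> real^'n \<Rightarrow> complex" where
  "gauss y x = complex_of_real (exp (- (4 * pi\<^sup>2 * (norm (x - y))\<^sup>2)))"

lemma gauss_measurable[measurable]: "case_prod gauss \<in> borel_measurable (borel \<Otimes>\<^sub>M borel)"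
  unfolding gauss_def case_prod_beta by measurable

lemma
  fixes y :: "real^'n"
  shows gauss_L2: "gauss y \<in> L2"
    and gauss_norm: "(L2_norm (gauss y))\<^sup>2 = (L2_norm (gauss (0::real^'n)))\<^sup>2"
proof -
  have m: "gauss (0::real^'n) \<in> borel_measurable borel" by measurable
  have sq: "(\<lambda>x::real^'n. (cmod (gauss 0 x))\<^sup>2) = (\<lambda>x. exp (- (8 * pi\<^sup>2) * (norm x)\<^sup>2))"
    by (auto simp: gauss_def norm_exp_eq_Re exp_double[symmetric] fun_eq_iff)
  have "integrable lborel (\<lambda>x::real^'n. (cmod (gauss 0 x))\<^sup>2)"
    unfolding sq by (rule integrable_gaussian) simp
  then have "integrable lebesgue (\<lambda>x::real^'n. (cmod (gauss 0 x))\<^sup>2)"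
    using m by (subst integrable_completion) auto
  then have L2: "gauss (0::real^'n) \<in> L2"
    using m by (auto simp: L2_def intro: measurable_completion)
  note id = linear_identity det_matrix_identity
  have eq: "gauss y = (\<lambda>x. gauss 0 (x + (- y)))" by (simp add: gauss_def fun_eq_iff)
  show "gauss y \<in> L2" unfolding eq by (rule L2_affine(1)[OF id(1) _ L2]) (simp add: id)
  show "(L2_norm (gauss y))\<^sup>2 = (L2_norm (gauss (0::real^'n)))\<^sup>2"
    unfolding eq by (subst L2_affine(2)[OF id(1) _ L2]) (simp_all add: id)
qed

lemma L2_inner_borel:
  assumes [measurable]: "f \<in> borel_measurable borel" "g \<in> borel_measurable borel"
  shows "L2_inner f g = (LINT x|lborel. f x * cnj (g x))"
  unfolding L2_inner_def by (rule integral_completion) measurable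

text \<open>Both sides are norms of the type in \<open>integral_square_kernel\<close>, with the
  kernels \<open>K1\<close> and \<open>gauss\<close>. The Gram kernels are
  \<open>sqrt (2 * pi) ^ CARD('n)\<close> and \<open>Ch\<close> times the same Gaussian in
  \<open>x - y\<close>; \<open>\<kappa>\<close> is the ratio of these constants.\<close>

lemma gaussian_Parseval:
  fixes u :: "real^'n \<Rightarrow> complex"
  defines "\<kappa> \<equiv> sqrt (2 * pi) ^ CARD('n) / (LINT t|lborel. exp (- (8 * pi\<^sup>2 * (norm (t::real^'n))\<^sup>2)))"
  assumes u: "integrable lborel u"
  shows "(\<integral>\<^sup>+\<xi>. ennreal (exp (- (norm \<xi>)\<^sup>2 / 2) * (cmod (fourier u \<xi>))\<^sup>2) \<partial>lborel) =
    ennreal \<kappa> * (\<integral>\<^sup>+t. ennreal ((cmod (L2_inner u (gauss t)))\<^sup>2) \<partial>lborel)"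
proof -
  define Ch where "Ch = (LINT t|lborel. exp (- (8 * pi\<^sup>2 * (norm (t::real^'n))\<^sup>2)))"
  have \<kappa>: "\<kappa> = sqrt (2 * pi) ^ CARD('n) / Ch" by (simp only: \<kappa>_def Ch_def)
  have Ch: "Ch > 0" unfolding Ch_def by (rule integral_gaussian_pos) simp
  have [measurable]: "u \<in> borel_measurable borel" using u by auto
  \<comment> \<open>The Fourier kernel times the square root of the weight, hence the 4: squaring
    the modulus restores the rate 1/2.\<close>
  define K1 where "K1 t x = complex_of_real (exp (- (norm t)\<^sup>2 / 4)) *
      exp (- (2 * complex_of_real pi * \<i> * complex_of_real (x \<bullet> t)))" for t x :: "real^'n"
  have [measurable]: "case_prod K1 \<in> borel_measurable (borel \<Otimes>\<^sub>M borel)"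
    unfolding K1_def case_prod_beta borel_prod
    by (intro borel_measurable_continuous_onI continuous_intros) auto
  have gauss_sq: "(cmod (gauss t x))\<^sup>2 = exp (- (8 * pi\<^sup>2) * (norm (x - t))\<^sup>2)" for t x :: "real^'n"
    by (auto simp: gauss_def norm_exp_eq_Re exp_double[symmetric] fun_eq_iff)
  have gauss_sym: "gauss t x = gauss x t" for t x :: "real^'n"
    by (simp add: gauss_def norm_minus_commute)
  have K1_sq: "(cmod (K1 t x))\<^sup>2 = exp (- (1/2) * (norm t)\<^sup>2)" for t x
    by (simp add: K1_def norm_mult power_mult_distrib norm_exp_eq_Re exp_double[symmetric])
  have K1_le: "cmod (K1 t x) \<le> 1" for t x
    by (simp add: K1_def norm_mult)
  have K1_int: "(\<integral>\<^sup>+t. ennreal ((cmod (K1 t x))\<^sup>2) \<partial>lborel) \<le> ennreal (LINT t|lborel. exp (- (1/2) * (norm (t::real^'n))\<^sup>2))" for x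
    unfolding K1_sq by (subst nn_integral_eq_integral[OF integrable_gaussian]) auto
  have gauss_le: "cmod (gauss t x) \<le> 1" for t x :: "real^'n"
    by (simp add: gauss_def)
  have gauss_int: "(\<integral>\<^sup>+t. ennreal ((cmod (gauss t x))\<^sup>2) \<partial>lborel) \<le> ennreal ((L2_norm (gauss (0::real^'n)))\<^sup>2)" for x :: "real^'n"
  proof -
    have "(\<integral>\<^sup>+t. ennreal ((cmod (gauss t x))\<^sup>2) \<partial>lborel) = (\<integral>\<^sup>+t. ennreal ((cmod (gauss x t))\<^sup>2) \<partial>lborel)"
      by (subst gauss_sym) simp
    also have "\<dots> = (\<integral>\<^sup>+t. ennreal ((cmod (gauss x t))\<^sup>2) \<partial>lebesgue)"
      by (simp add: nn_integral_completion)
    also have "\<dots> = ennreal ((L2_norm (gauss x))\<^sup>2)"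
      by (rule nn_integral_L2[OF gauss_L2])
    finally show ?thesis by (simp add: gauss_norm[of x])
  qed
  have gram1: "(LINT t|lborel. K1 t x * cnj (K1 t y)) = complex_of_real (sqrt (2 * pi) ^ CARD('n) * exp (- (2 * pi\<^sup>2 * (norm (x - y))\<^sup>2)))" for x y
  proof -
    have "K1 t x * cnj (K1 t y) = complex_of_real (exp (- (norm t)\<^sup>2 / 2)) *
        exp (- (2 * complex_of_real pi * \<i> * complex_of_real ((x - y) \<bullet> t)))" for t
    proof -
      have "complex_of_real (exp (- (norm t)\<^sup>2 / 4)) * complex_of_real (exp (- (norm t)\<^sup>2 / 4)) = complex_of_real (exp (- (norm t)\<^sup>2 / 2))"
        unfolding of_real_mult[symmetric] exp_add[symmetric] by simp
      moreover have "exp (- (2 * complex_of_real pi * \<i> * complex_of_real (x \<bullet> t))) *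
          cnj (exp (- (2 * complex_of_real pi * \<i> * complex_of_real (y \<bullet> t)))) =
          exp (- (2 * complex_of_real pi * \<i> * complex_of_real ((x - y) \<bullet> t)))"
        unfolding exp_cnj exp_add[symmetric] by (simp add: inner_diff_left algebra_simps)
      moreover have "K1 t x * cnj (K1 t y) =
          (complex_of_real (exp (- (norm t)\<^sup>2 / 4)) * complex_of_real (exp (- (norm t)\<^sup>2 / 4))) *
          (exp (- (2 * complex_of_real pi * \<i> * complex_of_real (x \<bullet> t))) *
          cnj (exp (- (2 * complex_of_real pi * \<i> * complex_of_real (y \<bullet> t)))))"
        by (simp add: K1_def)
      ultimately show ?thesis by (simp only:)
    qed
    then show ?thesis using integral_gaussian_phase_euclidean[of "x - y"] by simp
  qed
  have gram2: "(LINT t|lborel. gauss t x * cnj (gauss t y)) = complex_of_real (exp (- (2 * pi\<^sup>2 * (norm (x - y))\<^sup>2)) * Ch)" for x y :: "real^'n"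
  proof -
    have "gauss t x * cnj (gauss t y) = complex_of_real (exp (- (4 * pi\<^sup>2 * (norm (t - x))\<^sup>2)) * exp (- (4 * pi\<^sup>2 * (norm (t - y))\<^sup>2)))" for t
      by (simp add: gauss_def norm_minus_commute)
    then show ?thesis
      using autocorrelation_gaussian[of x y] by (simp add: Ch_def del: of_real_mult)
  qed
  have F: "exp (- (norm \<xi>)\<^sup>2 / 2) * (cmod (fourier u \<xi>))\<^sup>2 = (cmod (LINT x|lborel. K1 \<xi> x * u x))\<^sup>2" for \<xi>
  proof -
    have m: "(\<lambda>x. u x * exp (- (2 * complex_of_real pi * \<i> * complex_of_real (x \<bullet> \<xi>)))) \<in> borel_measurable lborel"
      by measurable
    have "(LINT x|lborel. K1 \<xi> x * u x) = (LINT x|lborel. complex_of_real (exp (- (norm \<xi>)\<^sup>2 / 4)) * (u x * exp (- (2 * complex_of_real pi * \<i> * complex_of_real (x \<bullet> \<xi>)))))"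
      by (simp add: K1_def mult_ac)
    also have "\<dots> = complex_of_real (exp (- (norm \<xi>)\<^sup>2 / 4)) * fourier u \<xi>"
      unfolding fourier_def by (subst integral_completion[OF m]) simp
    finally show ?thesis
      by (simp add: norm_mult power_mult_distrib norm_exp_eq_Re exp_double[symmetric])
  qed
  have S: "L2_inner u (gauss t) = (LINT x|lborel. gauss t x * u x)" for t
    by (subst L2_inner_borel) (auto simp: gauss_def mult.commute)
  have "complex_of_real (LINT t|lborel. (cmod (LINT x|lborel. K1 t x * u x))\<^sup>2) =
      (LINT (x, y)|(lborel \<Otimes>\<^sub>M lborel). complex_of_real \<kappa> * (u x * cnj (u y) * (LINT t|lborel. gauss t x * cnj (gauss t y))))"
    using Ch by (subst integral_square_kernel[OF _ K1_le K1_int u])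
      (auto simp: gram1 gram2 \<kappa> case_prod_beta mult_ac intro!: Bochner_Integration.integral_cong)
  also have "\<dots> = complex_of_real \<kappa> * complex_of_real (LINT t|lborel. (cmod (LINT x|lborel. gauss t x * u x))\<^sup>2)"
    unfolding integral_square_kernel[OF gauss_measurable gauss_le gauss_int u] case_prod_beta
    by (rule integral_mult_right_zero)
  finally have eq: "(LINT t|lborel. (cmod (LINT x|lborel. K1 t x * u x))\<^sup>2) = \<kappa> * (LINT t|lborel. (cmod (LINT x|lborel. gauss t x * u x))\<^sup>2)"
    unfolding of_real_mult[symmetric] of_real_eq_iff .
  have "integrable lborel (\<lambda>t. (cmod (LINT x|lborel. K1 t x * u x))\<^sup>2)"
    by (rule integrable_square_kernel[OF _ K1_le K1_int u]) measurable
  moreover have "integrable lborel (\<lambda>t. (cmod (LINT x|lborel. gauss t x * u x))\<^sup>2)"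
    by (rule integrable_square_kernel[OF gauss_measurable gauss_le gauss_int u])
  moreover have "0 \<le> \<kappa>" using Ch by (simp add: \<kappa>)
  ultimately show ?thesis
    unfolding F S by (subst (1 2) nn_integral_eq_integral) (auto simp: eq ennreal_mult)
qed

lemma gauss_measurable_fst: "gauss y \<in> borel_measurable borel"
  by measurable

lemma gauss_average_measurable[measurable]:
  assumes "f \<in> L2"
  shows "(\<lambda>t. L2_inner f (gauss t)) \<in> borel_measurable borel"
proof -
  obtain f' where f': "f' \<in> borel_measurable borel" "AE x in lebesgue. f x = f' x"
    by (rule lebesgue_borel_representative[OF L2_measurable[OF assms]])
  note [measurable] = f'(1)
  have "L2_inner f (gauss t) = (LINT x|lborel. f' x * cnj (gauss t x))" for t
    by (simp add: L2_inner_cong_AE[OF f'(2) assms f'(1) gauss_L2] L2_inner_borel f'(1) gauss_measurable_fst)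
  then show ?thesis by simp
qed

lemma L2_inner_add_left:
  assumes "f \<in> L2" "g \<in> L2" "h \<in> L2"
  shows "L2_inner (\<lambda>x. f x + g x) h = L2_inner f h + L2_inner g h"
  unfolding L2_inner_def using assms by (simp add: distrib_right L2_inner_integrable)

text \<open>Young's inequality for convolution with an integrable Gaussian of mass \<open>H\<close>.
  It makes the Gaussian averages depend continuously on \<open>f\<close>, as needed to pass from
  integrable approximants to \<open>L2\<close>.\<close>

lemma Young_gauss:
  fixes f :: "real^'n \<Rightarrow> complex"
  defines "H \<equiv> (LINT t|lborel. exp (- (4 * pi\<^sup>2) * (norm (t::real^'n))\<^sup>2))"
  assumes f: "f \<in> L2"
  shows "(\<integral>\<^sup>+t. ennreal ((cmod (L2_inner f (gauss t)))\<^sup>2) \<partial>lborel) \<le> ennreal (H\<^sup>2 * (L2_norm f)\<^sup>2)"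
proof -
  obtain f' where f': "f' \<in> borel_measurable borel" "AE x in lebesgue. f x = f' x"
    by (rule lebesgue_borel_representative[OF L2_measurable[OF f]])
  note [measurable] = f'(1)
  define h where "h t x = exp (- (4 * pi\<^sup>2) * (norm (x - t))\<^sup>2)" for t x :: "real^'n"
  have [measurable]: "case_prod h \<in> borel_measurable (borel \<Otimes>\<^sub>M borel)"
    unfolding h_def case_prod_beta by measurable
  have h0: "0 \<le> h t x" for t x by (simp add: h_def)
  have h_sym: "h t x = h x t" for t x by (simp add: h_def norm_minus_commute)
  have gauss_h: "gauss t x = complex_of_real (h t x)" for t x by (simp add: gauss_def h_def)
  have H0: "0 \<le> H" by (simp add: H_def)
  have h_int: "(\<integral>\<^sup>+x. ennreal (h t x) \<partial>lborel) = ennreal H" for t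
  proof -
    have "(\<integral>\<^sup>+x. ennreal (h t x) \<partial>lborel) = (\<integral>\<^sup>+x. ennreal (exp (- (4 * pi\<^sup>2) * (norm x)\<^sup>2)) \<partial>distr lborel borel ((+) (- t)))"
      by (subst nn_integral_distr) (auto simp: h_def)
    also have "\<dots> = ennreal H"
      unfolding lborel_distr_plus H_def by (rule nn_integral_eq_integral[OF integrable_gaussian]) auto
    finally show ?thesis .
  qed
  \<comment> \<open>Cauchy-Schwarz after splitting \<open>h = sqrt h * sqrt h\<close>: one factor
    integrates to \<open>H\<close>, the other keeps \<open>sqrt h\<close> next to \<open>f'\<close>.
    Integrating in \<open>t\<close> will produce the second \<open>H\<close>.\<close>
  have pointwise: "ennreal ((cmod (L2_inner f (gauss t)))\<^sup>2) \<le> ennreal H * (\<integral>\<^sup>+x. ennreal (h t x * (cmod (f' x))\<^sup>2) \<partial>lborel)" for t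
  proof -
    have "L2_inner f (gauss t) = (LINT x|lborel. f' x * cnj (gauss t x))"
      by (simp add: L2_inner_cong_AE[OF f'(2) f f'(1) gauss_L2] L2_inner_borel f'(1) gauss_measurable_fst)
    moreover have int: "integrable lborel (\<lambda>x. f' x * cnj (gauss t x))"
      using L2_inner_integrable[OF L2_cong_AE[OF f'(2) f f'(1)] gauss_L2, of t]
      by (subst (asm) integrable_completion) measurable
    ultimately have "ennreal (cmod (L2_inner f (gauss t))) \<le> (\<integral>\<^sup>+x. ennreal (norm (f' x * cnj (gauss t x))) \<partial>lborel)"
      by (simp only: integral_norm_bound_ennreal[OF int])
    also have "\<dots> = (\<integral>\<^sup>+x. ennreal (sqrt (h t x)) * ennreal (sqrt (h t x) * cmod (f' x)) \<partial>lborel)"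
      by (intro nn_integral_cong) (auto simp: norm_mult gauss_h h0 mult_ac simp flip: ennreal_mult)
    finally have "(ennreal (cmod (L2_inner f (gauss t))))\<^sup>2 \<le>
        (\<integral>\<^sup>+x. ennreal (sqrt (h t x)) * ennreal (sqrt (h t x) * cmod (f' x)) \<partial>lborel)\<^sup>2"
      by (intro power_mono) auto
    also have "\<dots> \<le> (\<integral>\<^sup>+x. (ennreal (sqrt (h t x)))\<^sup>2 \<partial>lborel) * (\<integral>\<^sup>+x. (ennreal (sqrt (h t x) * cmod (f' x)))\<^sup>2 \<partial>lborel)"
      by (rule Cauchy_Schwarz_nn_integral) measurable
    also have "\<dots> = (\<integral>\<^sup>+x. ennreal (h t x) \<partial>lborel) * (\<integral>\<^sup>+x. ennreal (h t x * (cmod (f' x))\<^sup>2) \<partial>lborel)"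
      by (simp add: ennreal_power power_mult_distrib h0)
    finally show ?thesis by (simp add: h_int ennreal_power)
  qed
  have "(\<integral>\<^sup>+t. ennreal ((cmod (L2_inner f (gauss t)))\<^sup>2) \<partial>lborel) \<le>
      (\<integral>\<^sup>+t. ennreal H * (\<integral>\<^sup>+x. ennreal (h t x * (cmod (f' x))\<^sup>2) \<partial>lborel) \<partial>lborel)"
    by (intro nn_integral_mono pointwise)
  also have "\<dots> = ennreal H * (\<integral>\<^sup>+t. \<integral>\<^sup>+x. ennreal (h t x * (cmod (f' x))\<^sup>2) \<partial>lborel \<partial>lborel)"
    by (rule nn_integral_cmult) measurable
  also have "(\<integral>\<^sup>+t. \<integral>\<^sup>+x. ennreal (h t x * (cmod (f' x))\<^sup>2) \<partial>lborel \<partial>lborel) =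
      (\<integral>\<^sup>+x. \<integral>\<^sup>+t. ennreal (h t x * (cmod (f' x))\<^sup>2) \<partial>lborel \<partial>lborel)"
    by (rule lborel_pair.Fubini'[symmetric]) measurable
  also have "\<dots> = (\<integral>\<^sup>+x. ennreal H * ennreal ((cmod (f' x))\<^sup>2) \<partial>lborel)"
  proof (intro nn_integral_cong)
    fix x
    have "(\<integral>\<^sup>+t. ennreal (h t x * (cmod (f' x))\<^sup>2) \<partial>lborel) = (\<integral>\<^sup>+t. ennreal (h x t) * ennreal ((cmod (f' x))\<^sup>2) \<partial>lborel)"
      by (subst h_sym) (simp add: ennreal_mult h0)
    also have "\<dots> = ennreal H * ennreal ((cmod (f' x))\<^sup>2)"
      by (subst nn_integral_multc) (auto simp: h_int)
    finally show "(\<integral>\<^sup>+t. ennreal (h t x * (cmod (f' x))\<^sup>2) \<partial>lborel) = ennreal H * ennreal ((cmod (f' x))\<^sup>2)" .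
  qed
  also have "\<dots> = ennreal H * (\<integral>\<^sup>+x. ennreal ((cmod (f' x))\<^sup>2) \<partial>lborel)"
    by (rule nn_integral_cmult) measurable
  also have "(\<integral>\<^sup>+x. ennreal ((cmod (f' x))\<^sup>2) \<partial>lborel) = (\<integral>\<^sup>+x. ennreal ((cmod (f x))\<^sup>2) \<partial>lebesgue)"
    unfolding nn_integral_completion[symmetric, where M=lborel]
    by (rule nn_integral_cong_AE) (use f'(2) in eventually_elim, simp)
  also have "\<dots> = ennreal ((L2_norm f)\<^sup>2)" by (rule nn_integral_L2[OF f])
  finally show ?thesis using H0 by (simp add: power2_eq_square ennreal_mult mult.assoc)
qed

lemma gaussian_Parseval_lebesgue:
  fixes u :: "real^'n \<Rightarrow> complex"
  defines "\<kappa> \<equiv> sqrt (2 * pi) ^ CARD('n) / (LINT t|lborel. exp (- (8 * pi\<^sup>2 * (norm (t::real^'n))\<^sup>2)))"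
  assumes u: "integrable lebesgue u" "u \<in> L2"
  shows "(\<integral>\<^sup>+\<xi>. ennreal (exp (- (norm \<xi>)\<^sup>2 / 2) * (cmod (fourier u \<xi>))\<^sup>2) \<partial>lborel) =
    ennreal \<kappa> * (\<integral>\<^sup>+t. ennreal ((cmod (L2_inner u (gauss t)))\<^sup>2) \<partial>lborel)"
proof -
  have um: "u \<in> borel_measurable lebesgue" using u by auto
  obtain u' where u': "u' \<in> borel_measurable borel" "AE x in lebesgue. u x = u' x"
    by (rule lebesgue_borel_representative[OF um])
  have u'm: "u' \<in> borel_measurable lebesgue" using u'(1) by (intro measurable_completion) simp
  have "integrable lebesgue u'"
    using u(1) by (subst integrable_cong_AE[OF u'm um]) (use u'(2) in \<open>auto elim: eventually_mono\<close>)
  then have int: "integrable lborel u'"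
    using u'(1) by (subst (asm) integrable_completion) auto
  have F: "fourier u = fourier u'"
  proof
    fix \<xi>
    have e: "(\<lambda>x::real^'n. exp (- (2 * complex_of_real pi * \<i> * complex_of_real (x \<bullet> \<xi>)))) \<in> borel_measurable lebesgue"
      by (intro measurable_completion) simp
    show "fourier u \<xi> = fourier u' \<xi>"
      unfolding fourier_def
      by (rule integral_cong_AE)
        (use um u'm e in measurable, use um u'm e in measurable, use u'(2) in eventually_elim, simp)
  qed
  show ?thesis
    using gaussian_Parseval[OF int]
    unfolding F L2_inner_cong_AE[OF u'(2) u(2) u'(1) gauss_L2] \<kappa>_def .
qed

text \<open>The identity for integrable functions is carried along an approximating sequence. The
  squared triangle inequality, used once on each side, loses 2 each time, whence
  \<open>C = 4 * \<kappa>\<close>. It matters that \<open>C\<close> is chosen before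
  \<open>f\<close> and \<open>g\<close>: the same constant will serve all scales.\<close>

lemma weighted_fourier_le_gauss_average:
  obtains C where "C \<ge> 0" "\<And>(f :: real^'n \<Rightarrow> complex) g. is_L2_fourier f g \<Longrightarrow>
    (\<integral>\<^sup>+\<xi>. ennreal (exp (- (norm \<xi>)\<^sup>2 / 2) * (cmod (g \<xi>))\<^sup>2) \<partial>lebesgue) \<le>
      ennreal C * (\<integral>\<^sup>+t. ennreal ((cmod (L2_inner f (gauss t)))\<^sup>2) \<partial>lborel)"
proof -
  define \<kappa> where "\<kappa> = sqrt (2 * pi) ^ CARD('n) / (LINT t|lborel. exp (- (8 * pi\<^sup>2 * (norm (t::real^'n))\<^sup>2)))"
  define H where "H = (LINT t|lborel. exp (- (4 * pi\<^sup>2) * (norm (t::real^'n))\<^sup>2))"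
  have \<kappa>0: "0 \<le> \<kappa>" by (simp add: \<kappa>_def)
  have main: "(\<integral>\<^sup>+\<xi>. ennreal (exp (- (norm \<xi>)\<^sup>2 / 2) * (cmod (g \<xi>))\<^sup>2) \<partial>lebesgue) \<le>
      ennreal (4 * \<kappa>) * (\<integral>\<^sup>+t. ennreal ((cmod (L2_inner f (gauss t)))\<^sup>2) \<partial>lborel)"
    if fg: "is_L2_fourier f g" for f g :: "real^'n \<Rightarrow> complex"
  proof -
    let ?w = "\<lambda>\<xi>::real^'n. exp (- (norm \<xi>)\<^sup>2 / 2)"
    define L where "L = (\<integral>\<^sup>+\<xi>. ennreal (?w \<xi> * (cmod (g \<xi>))\<^sup>2) \<partial>lebesgue)"
    define R where "R = (\<integral>\<^sup>+t. ennreal ((cmod (L2_inner f (gauss t)))\<^sup>2) \<partial>lborel)"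
    obtain u where u: "\<And>n. integrable lebesgue (u n)" "\<And>n::nat. u n \<in> L2" "\<And>n. fourier (u n) \<in> L2"
      "(\<lambda>n. L2_norm (\<lambda>x. u n x - f x)) \<longlonglongrightarrow> 0" "(\<lambda>n. L2_norm (\<lambda>\<xi>. fourier (u n) \<xi> - g \<xi>)) \<longlonglongrightarrow> 0"
      by (rule is_L2_fourierE[OF fg]) (rule that)
    note L2 = is_L2_fourier_L2[OF fg]
    note [measurable] = L2_measurable[OF L2(1)] L2_measurable[OF L2(2)] L2_measurable[OF u(2)] L2_measurable[OF u(3)]
    have wm[measurable]: "?w \<in> borel_measurable lebesgue"
      by (intro measurable_completion) simp
    \<comment> \<open>The total error of the two approximations: \<open>2 * \<kappa> * 2\<close>
      times the bound of \<open>Young_gauss\<close> on the side of \<open>f\<close>, and 2 times the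
      squared distance of the transforms on the side of \<open>g\<close>.\<close>
    define d where "d n = 4 * \<kappa> * H\<^sup>2 * (L2_norm (\<lambda>x. u n x - f x))\<^sup>2 + 2 * (L2_norm (\<lambda>\<xi>. fourier (u n) \<xi> - g \<xi>))\<^sup>2" for n
    have d0: "d n \<ge> 0" for n using \<kappa>0 by (simp add: d_def)
    have bound: "L \<le> ennreal (4 * \<kappa>) * R + ennreal (d n)" for n
    proof -
      have sq: "ennreal ((cmod b)\<^sup>2) \<le> 2 * ennreal ((cmod a)\<^sup>2) + 2 * ennreal ((cmod (a - b))\<^sup>2)" for a b
      proof -
        have "(cmod b)\<^sup>2 \<le> 2 * (cmod a)\<^sup>2 + 2 * (cmod (a - b))\<^sup>2"
          using cmod_add_square_le[of a "b - a"] by (simp add: norm_minus_commute)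
        then have "ennreal ((cmod b)\<^sup>2) \<le> ennreal (2 * (cmod a)\<^sup>2 + 2 * (cmod (a - b))\<^sup>2)"
          by (rule ennreal_leI)
        then show ?thesis by (simp add: ennreal_mult)
      qed
      have "(\<integral>\<^sup>+t. ennreal ((cmod (L2_inner (u n) (gauss t)))\<^sup>2) \<partial>lborel) \<le>
          (\<integral>\<^sup>+t. 2 * ennreal ((cmod (L2_inner f (gauss t)))\<^sup>2) + 2 * ennreal ((cmod (L2_inner (\<lambda>x. u n x - f x) (gauss t)))\<^sup>2) \<partial>lborel)"
      proof (rule nn_integral_mono)
        fix t
        have "L2_inner (u n) (gauss t) = L2_inner f (gauss t) + L2_inner (\<lambda>x. u n x - f x) (gauss t)"
          using L2_inner_add_left[OF L2(1) L2_diff[OF u(2) L2(1)] gauss_L2, of n t] by simp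
        then show "ennreal ((cmod (L2_inner (u n) (gauss t)))\<^sup>2) \<le>
            2 * ennreal ((cmod (L2_inner f (gauss t)))\<^sup>2) + 2 * ennreal ((cmod (L2_inner (\<lambda>x. u n x - f x) (gauss t)))\<^sup>2)"
          using sq[of "L2_inner (u n) (gauss t)" "L2_inner f (gauss t)"]
          by (simp add: norm_minus_commute)
      qed
      also have "\<dots> = 2 * R + 2 * (\<integral>\<^sup>+t. ennreal ((cmod (L2_inner (\<lambda>x. u n x - f x) (gauss t)))\<^sup>2) \<partial>lborel)"
        using L2 u(2) unfolding R_def
        by (subst nn_integral_add) (auto simp: nn_integral_cmult gauss_average_measurable L2_diff)
      also have "\<dots> \<le> 2 * R + 2 * ennreal (H\<^sup>2 * (L2_norm (\<lambda>x. u n x - f x))\<^sup>2)"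
        using Young_gauss[OF L2_diff[OF u(2) L2(1)], of n] unfolding H_def by (intro add_left_mono mult_left_mono) auto
      finally have 1: "(\<integral>\<^sup>+t. ennreal ((cmod (L2_inner (u n) (gauss t)))\<^sup>2) \<partial>lborel) \<le>
        2 * R + 2 * ennreal (H\<^sup>2 * (L2_norm (\<lambda>x. u n x - f x))\<^sup>2)" .
      have "L \<le> (\<integral>\<^sup>+\<xi>. 2 * ennreal (?w \<xi> * (cmod (fourier (u n) \<xi>))\<^sup>2) + 2 * ennreal ((cmod (fourier (u n) \<xi> - g \<xi>))\<^sup>2) \<partial>lebesgue)"
        unfolding L_def
      proof (rule nn_integral_mono)
        fix \<xi> :: "real^'n"
        have w: "0 \<le> ?w \<xi>" "?w \<xi> \<le> 1" by auto
        have "ennreal (?w \<xi> * (cmod (g \<xi>))\<^sup>2) = ennreal (?w \<xi>) * ennreal ((cmod (g \<xi>))\<^sup>2)"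
          by (simp add: ennreal_mult)
        also have "\<dots> \<le> ennreal (?w \<xi>) * (2 * ennreal ((cmod (fourier (u n) \<xi>))\<^sup>2) + 2 * ennreal ((cmod (fourier (u n) \<xi> - g \<xi>))\<^sup>2))"
          by (intro mult_left_mono sq) auto
        also have "\<dots> = 2 * (ennreal (?w \<xi>) * ennreal ((cmod (fourier (u n) \<xi>))\<^sup>2)) + ennreal (?w \<xi>) * (2 * ennreal ((cmod (fourier (u n) \<xi> - g \<xi>))\<^sup>2))"
          by (simp add: distrib_left mult_ac)
        \<comment> \<open>The weight is at most 1 and is dropped from the error term, because
          \<open>u\<close> is controlled in the unweighted norm.\<close>
        also have "\<dots> \<le> 2 * (ennreal (?w \<xi>) * ennreal ((cmod (fourier (u n) \<xi>))\<^sup>2)) + 1 * (2 * ennreal ((cmod (fourier (u n) \<xi> - g \<xi>))\<^sup>2))"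
          using w by (intro add_left_mono mult_right_mono) (auto simp: ennreal_le_1)
        finally show "ennreal (?w \<xi> * (cmod (g \<xi>))\<^sup>2) \<le> 2 * ennreal (?w \<xi> * (cmod (fourier (u n) \<xi>))\<^sup>2) + 2 * ennreal ((cmod (fourier (u n) \<xi> - g \<xi>))\<^sup>2)"
          by (simp add: ennreal_mult)
      qed
      also have "\<dots> = 2 * (\<integral>\<^sup>+\<xi>. ennreal (?w \<xi> * (cmod (fourier (u n) \<xi>))\<^sup>2) \<partial>lebesgue) + 2 * (\<integral>\<^sup>+\<xi>. ennreal ((cmod (fourier (u n) \<xi> - g \<xi>))\<^sup>2) \<partial>lebesgue)"
      proof -
        have m: "(\<lambda>\<xi>. ennreal (?w \<xi> * (cmod (fourier (u n) \<xi>))\<^sup>2)) \<in> borel_measurable lebesgue"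
          "(\<lambda>\<xi>. ennreal ((cmod (fourier (u n) \<xi> - g \<xi>))\<^sup>2)) \<in> borel_measurable lebesgue"
          by measurable
        show ?thesis
          unfolding nn_integral_cmult[OF m(1), symmetric] nn_integral_cmult[OF m(2), symmetric]
          by (rule nn_integral_add) (intro borel_measurable_times_ennreal borel_measurable_const m)+
      qed
      also have "(\<integral>\<^sup>+\<xi>. ennreal ((cmod (fourier (u n) \<xi> - g \<xi>))\<^sup>2) \<partial>lebesgue) = ennreal ((L2_norm (\<lambda>\<xi>. fourier (u n) \<xi> - g \<xi>))\<^sup>2)"
        by (rule nn_integral_L2[OF L2_diff[OF u(3) L2(2)]])
      also have "(\<integral>\<^sup>+\<xi>. ennreal (?w \<xi> * (cmod (fourier (u n) \<xi>))\<^sup>2) \<partial>lebesgue) =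
          ennreal \<kappa> * (\<integral>\<^sup>+t. ennreal ((cmod (L2_inner (u n) (gauss t)))\<^sup>2) \<partial>lborel)"
        unfolding nn_integral_completion \<kappa>_def by (rule gaussian_Parseval_lebesgue[OF u(1,2)])
      also have "2 * (ennreal \<kappa> * (\<integral>\<^sup>+t. ennreal ((cmod (L2_inner (u n) (gauss t)))\<^sup>2) \<partial>lborel)) +
          2 * ennreal ((L2_norm (\<lambda>\<xi>. fourier (u n) \<xi> - g \<xi>))\<^sup>2) \<le>
        2 * (ennreal \<kappa> * (2 * R + 2 * ennreal (H\<^sup>2 * (L2_norm (\<lambda>x. u n x - f x))\<^sup>2))) +
          2 * ennreal ((L2_norm (\<lambda>\<xi>. fourier (u n) \<xi> - g \<xi>))\<^sup>2)"
        by (intro add_right_mono mult_left_mono 1) auto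
      also have "\<dots> = ennreal (4 * \<kappa>) * R + ennreal (d n)"
      proof -
        have 2: "2 * ennreal x = ennreal (2 * x)" if "x \<ge> 0" for x using that by (simp add: ennreal_mult)
        have "2 * (ennreal \<kappa> * (2 * R)) = ennreal (4 * \<kappa>) * R"
        proof -
          have "ennreal (4 * \<kappa>) = 2 * (2 * ennreal \<kappa>)" using \<kappa>0 by (simp add: 2)
          then show ?thesis by (simp add: mult_ac)
        qed
        moreover have "2 * (ennreal \<kappa> * (2 * ennreal (H\<^sup>2 * (L2_norm (\<lambda>x. u n x - f x))\<^sup>2))) + 2 * ennreal ((L2_norm (\<lambda>\<xi>. fourier (u n) \<xi> - g \<xi>))\<^sup>2) = ennreal (d n)"
          using \<kappa>0 by (simp add: d_def 2 mult_ac flip: ennreal_mult ennreal_plus)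
        ultimately show ?thesis by (simp add: distrib_left add.assoc)
      qed
      finally show ?thesis .
    qed
    have "d \<longlonglongrightarrow> 4 * \<kappa> * H\<^sup>2 * 0\<^sup>2 + 2 * 0\<^sup>2"
      unfolding d_def by (intro tendsto_intros u)
    then have "(\<lambda>n. ennreal (d n)) \<longlonglongrightarrow> ennreal 0"
      by (intro tendsto_ennrealI) simp
    then have "(\<lambda>n. ennreal (4 * \<kappa>) * R + ennreal (d n)) \<longlonglongrightarrow> ennreal (4 * \<kappa>) * R + ennreal 0"
      by (rule tendsto_add[OF tendsto_const])
    then have "L \<le> ennreal (4 * \<kappa>) * R + ennreal 0"
      by (rule LIMSEQ_le_const) (use bound in auto)
    then show ?thesis by (simp add: L_def R_def)
  qed
  show thesis by (rule that[of "4 * \<kappa>"]) (use \<kappa>0 main in auto)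
qed

section \<open>Averaging over translations\<close>

lemma finite_bounded_int_lattice:
  assumes "bounded (S :: (real^'n) set)"
  shows "finite (int_lattice \<inter> S)"
proof -
  obtain R where R: "\<And>x. x \<in> S \<Longrightarrow> norm x \<le> R" using assms unfolding bounded_iff by blast
  define m where "m = \<lceil>R\<rceil>"
  let ?Z = "real_of_int ` {-m..m}"
  have "int_lattice \<inter> S \<subseteq> vec_lambda ` (Pi\<^sub>E UNIV (\<lambda>_. ?Z))"
  proof
    fix k assume k: "k \<in> int_lattice \<inter> S"
    have "k $ i \<in> ?Z" for i
    proof -
      have "k $ i \<in> \<int>" using k by (simp add: int_lattice_def)
      then obtain z where z: "k $ i = of_int z" by (rule Ints_cases)
      have "\<bar>k $ i\<bar> \<le> R" using R[of k] k component_le_norm_cart[of k i] by auto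
      then have "\<bar>z\<bar> \<le> m" unfolding z m_def by linarith
      then show ?thesis unfolding z by (intro imageI) auto
    qed
    then show "k \<in> vec_lambda ` (Pi\<^sub>E UNIV (\<lambda>_. ?Z))"
      by (intro image_eqI[of _ _ "vec_nth k"]) auto
  qed
  moreover have "finite (vec_lambda ` (Pi\<^sub>E UNIV (\<lambda>_. ?Z)) :: (real^'n) set)"
    by (intro finite_imageI finite_PiE) auto
  ultimately show ?thesis by (rule finite_subset)
qed

lemma linear_bijection:
  fixes T :: "real^'n \<Rightarrow> real^'n"
  assumes "linear T" "det (matrix T) \<noteq> 0"
  shows "bij T" "linear (inv T)"
proof -
  have "inj T" using assms det_nz_iff_inj by blast
  then show "bij T" using linear_injective_imp_surjective[OF assms(1)] by (simp add: bij_def)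
  show "linear (inv T)" using \<open>inj T\<close> assms(1) linear_injective_imp_surjective[OF assms(1)]
    by (metis bij_def inj_linear_imp_inv_linear)
qed

lemma emeasure_linear_image:
  fixes T :: "real^'n \<Rightarrow> real^'n"
  assumes T: "linear T" "det (matrix T) \<noteq> 0" and S: "S \<in> sets borel"
  shows "T ` S \<in> sets borel" "emeasure lborel (T ` S) = ennreal \<bar>det (matrix T)\<bar> * emeasure lborel S"
proof -
  note bij = linear_bijection[OF T]
  have "T ` S = inv T -` S" using bij(1) by (simp add: bij_vimage_eq_inv_image bij_imp_bij_inv inv_inv_eq)
  then show TS: "T ` S \<in> sets borel"
    using measurable_sets_borel[OF linear_borel_measurable[OF bij(2)] S] by simp
  have [measurable]: "T \<in> borel_measurable borel" by (rule linear_borel_measurable[OF T(1)])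
  have "emeasure lborel (T ` S) = emeasure (density (distr lborel borel T) (\<lambda>_. ennreal \<bar>det (matrix T)\<bar>)) (T ` S)"
    by (simp add: distr_lborel_linear[OF T])
  also have "\<dots> = ennreal \<bar>det (matrix T)\<bar> * emeasure lborel (T -` (T ` S))"
    using TS by (simp add: emeasure_density_const emeasure_distr)
  also have "T -` (T ` S) = S" using bij(1) by (simp add: inj_vimage_image_eq bij_is_inj)
  finally show "emeasure lborel (T ` S) = ennreal \<bar>det (matrix T)\<bar> * emeasure lborel S" .
qed

text \<open>A volume comparison. The image of the ball under \<open>T\<close> is covered by unit
  cubes with integer corners \<open>k\<close>, obtained by rounding coordinates down. The inverse
  image of the unit cube has norms below \<open>\<rho>\<close>, so each such corner satisfies the
  bound \<open>2 * \<rho>\<close>.\<close>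

lemma card_lattice_points_ge:
  fixes T :: "real^'n \<Rightarrow> real^'n"
  assumes T: "linear T" "det (matrix T) \<noteq> 0"
    and cube: "\<And>x. x \<in> cbox 0 (\<chi> i. 1) \<Longrightarrow> norm (inv T x) < \<rho>"
  defines "K \<equiv> {k \<in> int_lattice. norm (inv T k) < 2 * \<rho>}"
  shows "finite K" "ennreal \<bar>det (matrix T)\<bar> * emeasure lborel (ball (0::real^'n) \<rho>) \<le> ennreal (card K)"
proof -
  note bij = linear_bijection[OF T]
  have "K \<subseteq> int_lattice \<inter> T ` ball 0 (2 * \<rho>)"
    using bij(1) by (auto simp: K_def bij_is_surj image_iff surj_f_inv_f intro!: bexI[of _ "inv T _"])
  moreover have "bounded (T ` ball 0 (2 * \<rho>))"
    using T(1) by (intro bounded_linear_image bounded_ball) (simp add: linear_conv_bounded_linear)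
  ultimately show fin: "finite K"
    using finite_bounded_int_lattice finite_subset by blast
  let ?Q = "\<lambda>k::real^'n. cbox k (k + (\<chi> i. 1))"
  have sub: "T ` ball 0 \<rho> \<subseteq> (\<Union>k\<in>K. ?Q k)"
  proof clarsimp
    fix x :: "real^'n" assume x: "norm x < \<rho>"
    define k where "k = (\<chi> i. real_of_int \<lfloor>T x $ i\<rfloor>)"
    have "T x - k \<in> cbox 0 (\<chi> i. 1)"
      by (auto simp: mem_box_cart k_def) linarith
    then have "norm (inv T (T x - k)) < \<rho>" by (rule cube)
    moreover have "inv T k = x - inv T (T x - k)"
      using bij by (simp add: linear_diff bij_is_inj)
    ultimately have "norm (inv T k) < 2 * \<rho>"
      using x norm_triangle_ineq4[of x "inv T (T x - k)"] by simp
    moreover have "k \<in> int_lattice" by (simp add: k_def int_lattice_def)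
    ultimately have "k \<in> K" by (simp add: K_def)
    moreover have "T x \<in> ?Q k"
      by (auto simp: mem_box_cart k_def)
    ultimately show "\<exists>k\<in>K. T x \<in> ?Q k" by blast
  qed
  have Q1: "emeasure lborel (?Q k) = 1" for k
  proof -
    have "(\<chi> i. 1) \<bullet> b = 1" if "b \<in> Basis" for b :: "real^'n"
      using that by (auto simp: Basis_vec_def inner_axis)
    then show ?thesis by (simp add: emeasure_lborel_cbox_eq inner_add_left)
  qed
  have "ennreal \<bar>det (matrix T)\<bar> * emeasure lborel (ball (0::real^'n) \<rho>) = emeasure lborel (T ` ball 0 \<rho>)"
    by (rule emeasure_linear_image(2)[OF T, symmetric]) simp
  also have "\<dots> \<le> emeasure lborel (\<Union>k\<in>K. ?Q k)"
    using sub fin by (intro emeasure_mono) auto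
  also have "\<dots> \<le> (\<Sum>k\<in>K. emeasure lborel (?Q k))"
    using fin by (intro emeasure_subadditive_finite) auto
  also have "\<dots> = ennreal (card K)" by (simp add: Q1 ennreal_of_nat_eq_real_of_nat)
  finally show "ennreal \<bar>det (matrix T)\<bar> * emeasure lborel (ball (0::real^'n) \<rho>) \<le> ennreal (card K)" .
qed

lemma nn_integral_lborel_translation:
  fixes f :: "'a::euclidean_space \<Rightarrow> ennreal"
  assumes "f \<in> borel_measurable borel"
  shows "(\<integral>\<^sup>+y. f (y - z) \<partial>lborel) = (\<integral>\<^sup>+y. f y \<partial>lborel)"
proof -
  have "(\<integral>\<^sup>+y. f y \<partial>lborel) = (\<integral>\<^sup>+y. f y \<partial>distr lborel borel ((+) (- z)))"
    by (simp add: lborel_distr_plus)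
  also have "\<dots> = (\<integral>\<^sup>+y. f (y - z) \<partial>lborel)"
    using assms by (subst nn_integral_distr) auto
  finally show ?thesis ..
qed

text \<open>If \<open>z = inv (T j) k\<close> has norm below \<open>2 * \<rho>\<close>, the integral
  of \<open>P j\<close> over the ball of radius \<open>\<rho>\<close> is at most that of
  \<open>P j (y - z)\<close> over the ball of radius \<open>3 * \<rho>\<close>. There are at least
  the determinant times the volume \<open>?b\<close> of such \<open>k\<close>. Summing over them and
  using \<open>bound\<close> under the integral gives the claim on the small ball, with the volume
  ratio \<open>3 ^ CARD('n)\<close> as constant; then the radius tends to infinity.\<close>

lemma sum_nn_integral_le_of_lattice_bound:
  fixes P :: "nat \<Rightarrow> real^'n \<Rightarrow> ennreal" and T :: "nat \<Rightarrow> real^'n \<Rightarrow> real^'n"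
  assumes P[measurable]: "\<And>j. P j \<in> borel_measurable borel"
    and T: "\<And>j. linear (T j)" "\<And>j. det (matrix (T j)) \<noteq> 0"
    and bound: "\<And>K y. (\<And>j. finite (K j)) \<Longrightarrow> (\<And>j. K j \<subseteq> int_lattice) \<Longrightarrow>
      (\<Sum>j<J. \<Sum>k\<in>K j. P j (y - inv (T j) k)) \<le> B"
  shows "(\<Sum>j<J. ennreal \<bar>det (matrix (T j))\<bar> * (\<integral>\<^sup>+y. P j y \<partial>lborel)) \<le> 3 ^ CARD('n) * B"
proof -
  have "\<exists>\<rho>0. \<forall>x\<in>cbox 0 (\<chi> i. 1). norm (inv (T j) x) < \<rho>0" for j
  proof -
    have "bounded (inv (T j) ` cbox 0 (\<chi> i. 1))"
      using linear_bijection[OF T(1)[of j] T(2)[of j]]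
      by (intro bounded_linear_image bounded_cbox) (simp add: linear_conv_bounded_linear)
    then obtain b where "\<forall>x\<in>cbox 0 (\<chi> i. 1). norm (inv (T j) x) \<le> b" unfolding bounded_iff by auto
    then show ?thesis by (intro exI[of _ "b + 1"]) force
  qed
  then obtain \<rho>0 where \<rho>0: "\<And>j x. x \<in> cbox 0 (\<chi> i. 1) \<Longrightarrow> norm (inv (T j) x) < \<rho>0 j" by metis
  \<comment> \<open>One radius for all scales below \<open>J\<close>, which are finitely many. The
    absolute values ensure that each \<open>\<rho>0 j\<close> is at most the sum.\<close>
  define \<rho>1 where "\<rho>1 = (\<Sum>j<J. \<bar>\<rho>0 j\<bar>)"
  have \<rho>1: "norm (inv (T j) x) < \<rho>" if "x \<in> cbox 0 (\<chi> i. 1)" "j < J" "\<rho>1 \<le> \<rho>" for j x \<rho>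
  proof -
    have "\<rho>0 j \<le> \<bar>\<rho>0 j\<bar>" by simp
    also have "\<dots> \<le> \<rho>1" unfolding \<rho>1_def using that by (intro member_le_sum) auto
    finally show ?thesis using \<rho>0[OF that(1), of j] that by simp
  qed
  have local: "(\<Sum>j<J. ennreal \<bar>det (matrix (T j))\<bar> * (\<integral>\<^sup>+y. P j y * indicator (ball 0 \<rho>) y \<partial>lborel)) \<le> 3 ^ CARD('n) * B"
    if \<rho>: "\<rho>1 \<le> \<rho>" "0 < \<rho>" for \<rho>
  proof -
    let ?b = "emeasure lborel (ball (0::real^'n) \<rho>)"
    \<comment> \<open>\<open>\<rho>1\<close> says nothing about \<open>j \<ge> J\<close>, yet
      \<open>bound\<close> asks for finite sets at every index; hence the empty default.\<close>
    define K where "K j = (if j < J then {k \<in> int_lattice. norm (inv (T j) k) < 2 * \<rho>} else {})" for j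
    define I where "I j = (\<integral>\<^sup>+y. P j y * indicator (ball 0 \<rho>) y \<partial>lborel)" for j
    have K: "finite (K j)" "K j \<subseteq> int_lattice" for j
      using card_lattice_points_ge(1)[OF T(1)[of j] T(2)[of j] \<rho>1] \<rho> by (auto simp: K_def)
    have card: "ennreal \<bar>det (matrix (T j))\<bar> * ?b \<le> ennreal (card (K j))" if "j < J" for j
      using card_lattice_points_ge(2)[OF T(1)[of j] T(2)[of j] \<rho>1] \<rho> that by (simp add: K_def)
    have I_le: "I j \<le> (\<integral>\<^sup>+y. P j (y - inv (T j) k) * indicator (ball 0 (3 * \<rho>)) y \<partial>lborel)"
      if "k \<in> K j" for j k
    proof -
      let ?z = "inv (T j) k"
      have z: "norm ?z < 2 * \<rho>" using that by (auto simp: K_def split: if_splits)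
      have "I j = (\<integral>\<^sup>+y. P j (y - ?z) * indicator (ball 0 \<rho>) (y - ?z) \<partial>lborel)"
        unfolding I_def by (rule nn_integral_lborel_translation[symmetric])
          (intro borel_measurable_times_ennreal P borel_measurable_indicator, simp)
      also have "\<dots> \<le> (\<integral>\<^sup>+y. P j (y - ?z) * indicator (ball 0 (3 * \<rho>)) y \<partial>lborel)"
      proof (rule nn_integral_mono, rule mult_left_mono)
        fix y
        show "indicator (ball 0 \<rho>) (y - ?z) \<le> (indicator (ball 0 (3 * \<rho>)) y :: ennreal)"
          using norm_triangle_ineq[of "y - ?z" ?z] z by (auto simp: indicator_def)
      qed simp
      finally show ?thesis .
    qed
    have "(\<Sum>j<J. ennreal \<bar>det (matrix (T j))\<bar> * I j) * ?b = (\<Sum>j<J. (ennreal \<bar>det (matrix (T j))\<bar> * ?b) * I j)"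
      unfolding sum_distrib_right by (intro sum.cong refl) (simp add: mult_ac)
    also have "\<dots> \<le> (\<Sum>j<J. ennreal (card (K j)) * I j)"
      by (intro sum_mono mult_right_mono card) auto
    also have "\<dots> = (\<Sum>j<J. \<Sum>k\<in>K j. I j)" by (simp add: ennreal_of_nat_eq_real_of_nat)
    also have "\<dots> \<le> (\<Sum>j<J. \<Sum>k\<in>K j. \<integral>\<^sup>+y. P j (y - inv (T j) k) * indicator (ball 0 (3 * \<rho>)) y \<partial>lborel)"
      by (intro sum_mono I_le)
    also have "\<dots> = (\<integral>\<^sup>+y. (\<Sum>j<J. \<Sum>k\<in>K j. P j (y - inv (T j) k)) * indicator (ball 0 (3 * \<rho>)) y \<partial>lborel)"
    proof -
      have [measurable]: "indicator (ball (0::real^'n) (3 * \<rho>)) \<in> borel_measurable (borel :: (real^'n) measure)"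
        by (intro borel_measurable_indicator) simp
      have "(\<lambda>y. P j (y - z) * indicator (ball 0 (3 * \<rho>)) y) \<in> borel_measurable lborel" for j z
        by measurable
      then show ?thesis unfolding sum_distrib_right
        by (subst nn_integral_sum, simp, intro sum.cong refl nn_integral_sum[symmetric])
    qed
    also have "\<dots> \<le> (\<integral>\<^sup>+y. B * indicator (ball (0::real^'n) (3 * \<rho>)) y \<partial>lborel)"
    proof (rule nn_integral_mono)
      fix y
      have "(\<Sum>j<J. \<Sum>k\<in>K j. P j (y - inv (T j) k)) \<le> B" by (rule bound) (rule K)+
      then show "(\<Sum>j<J. \<Sum>k\<in>K j. P j (y - inv (T j) k)) * indicator (ball 0 (3 * \<rho>)) y \<le> B * indicator (ball 0 (3 * \<rho>)) y"
        by (rule mult_right_mono) simp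
    qed
    also have "\<dots> = B * emeasure lborel (ball (0::real^'n) (3 * \<rho>))"
      by (rule nn_integral_cmult_indicator) simp
    also have "emeasure lborel (ball (0::real^'n) (3 * \<rho>)) = 3 ^ CARD('n) * ?b"
      using \<rho> by (simp add: emeasure_ball power_mult_distrib ennreal_mult mult_ac flip: ennreal_power)
    finally have "(\<Sum>j<J. ennreal \<bar>det (matrix (T j))\<bar> * I j) * ?b \<le> (3 ^ CARD('n) * B) * ?b"
      by (simp add: mult_ac)
    moreover have "0 < ?b" "?b < \<top>"
      using \<rho> by (auto simp: emeasure_ball unit_ball_vol_pos)
    ultimately show ?thesis
      unfolding I_def by (simp add: ennreal_mult_le_mult_iff mult.commute[of _ ?b])
  qed
  let ?I = "\<lambda>j m. \<integral>\<^sup>+y. P j y * indicator (ball 0 (real m)) y \<partial>lborel"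
  have "?I j \<longlonglongrightarrow> (\<integral>\<^sup>+y. P j y \<partial>lborel)" for j
  proof (rule nn_integral_LIMSEQ)
    show "incseq (\<lambda>m y. P j y * indicator (ball 0 (real m)) y)"
      by (auto simp: incseq_def le_fun_def indicator_def)
    show "(\<lambda>m. P j y * indicator (ball 0 (real m)) y) \<longlonglongrightarrow> P j y" for y
    proof (rule tendsto_eventually)
      have "\<forall>\<^sub>F m in sequentially. norm y < real m"
        by (rule eventually_compose_filterlim[OF eventually_gt_at_top filterlim_real_sequentially])
      then show "\<forall>\<^sub>F m in sequentially. P j y * indicator (ball 0 (real m)) y = P j y"
        by eventually_elim simp
    qed
  qed (simp, intro borel_measurable_times_ennreal P borel_measurable_indicator, simp)
  then have "(\<lambda>m. \<Sum>j<J. ennreal \<bar>det (matrix (T j))\<bar> * ?I j m) \<longlonglongrightarrow>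
      (\<Sum>j<J. ennreal \<bar>det (matrix (T j))\<bar> * (\<integral>\<^sup>+y. P j y \<partial>lborel))"
    by (intro tendsto_sum ennreal_tendsto_cmult) auto
  moreover have "\<forall>\<^sub>F m in sequentially. \<rho>1 < real m"
    by (rule eventually_compose_filterlim[OF eventually_gt_at_top filterlim_real_sequentially])
  then have "\<forall>\<^sub>F m in sequentially. (\<Sum>j<J. ennreal \<bar>det (matrix (T j))\<bar> * ?I j m) \<le> 3 ^ CARD('n) * B"
    using eventually_gt_at_top[of 0] by eventually_elim (rule local, auto)
  ultimately show ?thesis
    by (rule tendsto_upperbound) simp
qed

section \<open>Approximate continuity from decay of dilated averages\<close>

lemma linear_funpow:
  fixes A :: "real^'n \<Rightarrow> real^'n"
  assumes "linear A"
  shows "linear (A ^^ j)" and "det (matrix (A ^^ j)) = det (matrix A) ^ j"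
proof -
  have "linear (A ^^ j) \<and> det (matrix (A ^^ j)) = det (matrix A) ^ j"
  proof (induction j)
    case 0
    show ?case using linear_identity det_matrix_identity by (simp add: id_def)
  next
    case (Suc j)
    then have j: "linear (A ^^ j)" "det (matrix (A ^^ j)) = det (matrix A) ^ j" by auto
    show ?case
      unfolding funpow.simps(2) matrix_compose[OF j(1) assms] det_mul j(2)
      using linear_compose[OF j(1) assms] by (intro conjI) (assumption, rule power_Suc[symmetric])
  qed
  then show "linear (A ^^ j)" "det (matrix (A ^^ j)) = det (matrix A) ^ j" by auto
qed

lemma int_funpow_of_nat: "int_funpow F (int j) = F ^^ j"
  and int_funpow_minus_of_nat: "int_funpow F (- int j) = inv F ^^ j"
  by (auto simp: int_funpow_def)

lemma approx_continuous_origin_of_decay: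
  fixes M :: "real^'n \<Rightarrow> real^'n" and g :: "real^'n \<Rightarrow> complex"
  defines "I \<equiv> \<lambda>j. \<integral>\<^sup>+\<xi>. ennreal (exp (- (norm \<xi>)\<^sup>2 / 2) * (cmod (g ((inv M ^^ j) \<xi>)))\<^sup>2) \<partial>lebesgue"
  assumes M: "linear M" "det (matrix M) \<noteq> 0"
    and g: "g \<in> borel_measurable lebesgue"
    and fin: "\<And>j. I j < \<infinity>" and lim: "I \<longlonglongrightarrow> 0"
  shows "approx_continuous_origin M (g(0 := 0))"
proof -
  define T where "T j = inv M ^^ j" for j
  note bij = linear_bijection[OF M]
  have T: "linear (T j)" "det (matrix (T j)) \<noteq> 0" for j
  proof -
    have "det (matrix (inv M)) \<noteq> 0"
      using bij by (simp add: det_nz_iff_inj bij_is_inj bij_imp_bij_inv)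
    then show "linear (T j)" "det (matrix (T j)) \<noteq> 0"
      using linear_funpow[OF bij(2), of j] by (auto simp: T_def)
  qed
  have T_inj: "inj (T j)" for j using T det_nz_iff_inj by blast
  have Tm: "(\<lambda>\<xi>. f (T j \<xi>)) \<in> measurable lebesgue N" if "f \<in> measurable lebesgue N" for f j and N :: "'b measure"
    using measurable_lebesgue_affine[OF T(1)[of j] T(2)[of j] that, of 0] by simp
  let ?w = "\<lambda>\<xi>::real^'n. exp (- (norm \<xi>)\<^sup>2 / 2)"
  have norm_m[measurable]: "(norm :: real^'n \<Rightarrow> real) \<in> borel_measurable lebesgue"
    by (intro measurable_completion) simp
  have wm[measurable]: "?w \<in> borel_measurable lebesgue"
    by (intro measurable_completion) simp
  note [measurable] = g Tm[OF g] Tm[OF norm_m]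
  define F where "F j \<xi> = ennreal (?w \<xi> * (cmod (g (T j \<xi>)))\<^sup>2)" for j \<xi>
  have Fm[measurable]: "F j \<in> borel_measurable lebesgue" for j
    unfolding F_def by measurable
  have I: "I j = (\<integral>\<^sup>+\<xi>. F j \<xi> \<partial>lebesgue)" for j
    by (simp add: I_def F_def T_def)
  define a where "a r j = (\<integral>\<^sup>+\<xi>. F j \<xi> * (if norm (T j \<xi>) < r then 1 else 0) \<partial>lebesgue)" for r j
  have a_le: "a r j \<le> I j" for r j
    unfolding a_def I by (intro nn_integral_mono) auto
  \<comment> \<open>One radius for all \<open>j\<close>: from some \<open>J\<close> on, the whole
    integral \<open>I j\<close> is below the threshold whatever the radius. For the finitely many
    earlier \<open>j\<close>, dominated convergence makes the part near the origin small.\<close>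
  have small_radius: "\<exists>r>0. \<forall>j. a r j \<le> \<delta>" if "0 < \<delta>" for \<delta>
  proof -
    have "\<forall>\<^sub>F j in sequentially. I j < \<delta>" by (rule order_tendstoD(2)[OF lim that])
    then obtain J where J: "\<And>j. j \<ge> J \<Longrightarrow> I j < \<delta>" by (auto simp: eventually_sequentially)
    have "\<forall>\<^sub>F m in sequentially. a (1 / real (Suc m)) j < \<delta>" for j
    proof (rule order_tendstoD(2)[OF _ that])
      have "(\<lambda>m. \<integral>\<^sup>+\<xi>. F j \<xi> * (if norm (T j \<xi>) < 1 / real (Suc m) then 1 else 0) \<partial>lebesgue)
          \<longlonglongrightarrow> (\<integral>\<^sup>+(\<xi>::real^'n). 0 \<partial>lebesgue)"
      proof (rule nn_integral_dominated_convergence[where w="F j"])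
        have "AE \<xi> in lebesgue. \<xi> \<noteq> (0 :: real^'n)"
          by (rule AE_completion) (rule AE_lborel_singleton)
        then show "AE \<xi> in lebesgue. (\<lambda>m. F j \<xi> * (if norm (T j \<xi>) < 1 / real (Suc m) then 1 else 0)) \<longlonglongrightarrow> 0"
        proof eventually_elim
          fix \<xi> :: "real^'n" assume "\<xi> \<noteq> 0"
          then have "T j \<xi> \<noteq> 0" using T_inj[of j] linear_0[OF T(1)[of j]] by (metis injD)
          then have "\<forall>\<^sub>F m in sequentially. 1 / real (Suc m) < norm (T j \<xi>)"
            using order_tendstoD(2)[OF LIMSEQ_inverse_real_of_nat, of "norm (T j \<xi>)"]
            by (simp add: inverse_eq_divide)
          then have "\<forall>\<^sub>F m in sequentially. F j \<xi> * (if norm (T j \<xi>) < 1 / real (Suc m) then 1 else 0) = 0"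
            by eventually_elim simp
          then show "(\<lambda>m. F j \<xi> * (if norm (T j \<xi>) < 1 / real (Suc m) then 1 else 0)) \<longlonglongrightarrow> 0"
            by (rule tendsto_eventually)
        qed
      qed (use fin[of j] I in auto)
      then show "(\<lambda>m. a (1 / real (Suc m)) j) \<longlonglongrightarrow> 0" unfolding a_def by simp
    qed
    then have "\<forall>\<^sub>F m in sequentially. \<forall>j\<in>{..<J}. a (1 / real (Suc m)) j < \<delta>"
      by (intro eventually_ball_finite) auto
    then obtain m where m: "\<forall>j\<in>{..<J}. a (1 / real (Suc m)) j < \<delta>"
      by (auto simp: eventually_sequentially)
    have "a (1 / real (Suc m)) j \<le> \<delta>" for j
      using m J[of j] a_le[of "1 / real (Suc m)" j] by (cases "j < J") (auto intro: less_imp_le order_trans)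
    then show ?thesis by (intro exI[of _ "1 / real (Suc m)"]) auto
  qed
  \<comment> \<open>The denominator offsets the factor \<open>Suc n\<close> from Chebyshev's
    inequality at level \<open>1 / real (Suc n)\<close>; what is left is summable in
    \<open>n\<close> and dominates the series \<open>D j\<close>.\<close>
  define \<delta> where "\<delta> n = ennreal ((1/2) ^ n / real (Suc n))" for n
  have "\<forall>n. \<exists>r>0. \<forall>j. a r j \<le> \<delta> n"
    by (intro allI small_radius) (simp add: \<delta>_def)
  then obtain r where r: "\<And>n. r n > 0" "\<And>n j. a (r n) j \<le> \<delta> n" by metis
  \<comment> \<open>The radii are not monotone in \<open>n\<close>, so the condition is imposed for
    every \<open>n\<close> with \<open>norm \<eta> < r n\<close>. The limit along \<open>E\<close>
    can then be read off for each \<open>n\<close> separately.\<close>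
  define E where "E = {\<eta>. \<forall>n. norm \<eta> < r n \<longrightarrow> (cmod (g \<eta>))\<^sup>2 \<le> 1 / real (Suc n)}"
  have Em[measurable]: "E \<in> sets lebesgue"
  proof -
    have "{\<eta> \<in> space lebesgue. \<forall>n. norm \<eta> < r n \<longrightarrow> (cmod (g \<eta>))\<^sup>2 \<le> 1 / real (Suc n)} \<in> sets lebesgue"
      by measurable
    then show ?thesis unfolding E_def by (simp only: space_completion space_lborel space_borel UNIV_I simp_thms)
  qed
  \<comment> \<open>The union bound over all levels \<open>n\<close>. Each term tends to 0 since
    \<open>a (r n) j \<le> I j\<close>, and dominated convergence for the counting measure handles
    the series.\<close>
  define D where "D j = (\<Sum>n. of_nat (Suc n) * a (r n) j)" for j
  have "D \<longlonglongrightarrow> 0"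
  proof -
    have le: "of_nat (Suc n) * a (r n) j \<le> ennreal ((1/2) ^ n)" for n j
    proof -
      have "of_nat (Suc n) * a (r n) j \<le> of_nat (Suc n) * \<delta> n" by (intro mult_left_mono r) auto
      also have "\<dots> = ennreal ((1/2) ^ n)"
        unfolding \<delta>_def ennreal_of_nat_eq_real_of_nat by (subst ennreal_mult'[symmetric]) auto
      finally show ?thesis .
    qed
    have "(\<lambda>j. \<integral>\<^sup>+n. of_nat (Suc n) * a (r n) j \<partial>count_space UNIV) \<longlonglongrightarrow> (\<integral>\<^sup>+(n::nat). 0 \<partial>count_space UNIV)"
    proof (rule nn_integral_dominated_convergence[where w="\<lambda>n. ennreal ((1/2) ^ n)"])
      have "(\<integral>\<^sup>+n. ennreal ((1/2) ^ n) \<partial>count_space UNIV) = (\<Sum>n. ennreal ((1/2) ^ n))"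
        by (rule nn_integral_count_space_nat)
      also have "\<dots> < \<infinity>"
        by (subst suminf_ennreal2) (auto intro: summable_geometric)
      finally show "(\<integral>\<^sup>+n. ennreal ((1/2) ^ n) \<partial>count_space UNIV) < \<infinity>" .
      have "(\<lambda>j. of_nat (Suc n) * a (r n) j) \<longlonglongrightarrow> 0" for n
      proof -
        have "(\<lambda>j. a (r n) j) \<longlonglongrightarrow> 0"
          by (rule tendsto_sandwich[OF _ _ tendsto_const lim]) (auto simp: a_le)
        then have "(\<lambda>j. of_nat (Suc n) * a (r n) j) \<longlonglongrightarrow> of_nat (Suc n) * 0"
          by (intro ennreal_tendsto_cmult) (auto simp: ennreal_of_nat_eq_real_of_nat)
        then show ?thesis by simp
      qed
      then show "AE n in count_space UNIV. (\<lambda>j. of_nat (Suc n) * a (r n) j) \<longlonglongrightarrow> 0" by simp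
    qed (use le in auto)
    then show ?thesis unfolding D_def nn_integral_count_space_nat by simp
  qed
  \<comment> \<open>If \<open>T j \<xi>\<close> is outside \<open>E\<close>, some level
    \<open>n\<close> is violated there, and the \<open>n\<close>-th term of the series is at least
    1, because the weight on the ball is at least \<open>exp (- R\<^sup>2 / 2)\<close>.\<close>
  have bad: "emeasure lebesgue (ball 0 R \<inter> {\<xi>. T j \<xi> \<notin> E}) \<le> ennreal (exp (R\<^sup>2 / 2)) * D j" for R j
  proof -
    have Bm: "ball 0 R \<inter> {\<xi>. T j \<xi> \<notin> E} \<in> sets lebesgue"
    proof -
      have "{\<xi> \<in> space lebesgue. T j \<xi> \<notin> E} \<in> sets lebesgue"
        using measurable_sets[OF Tm[OF measurable_ident, of j], of "UNIV - E"] sets.compl_sets[OF Em]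
        by (simp add: vimage_def id_def)
      then show ?thesis by (intro sets.Int) auto
    qed
    have "emeasure lebesgue (ball 0 R \<inter> {\<xi>. T j \<xi> \<notin> E}) = (\<integral>\<^sup>+\<xi>. indicator (ball 0 R \<inter> {\<xi>. T j \<xi> \<notin> E}) \<xi> \<partial>lebesgue)"
      using Bm by simp
    also have "\<dots> \<le> (\<integral>\<^sup>+\<xi>. (\<Sum>n. ennreal (exp (R\<^sup>2 / 2)) * (of_nat (Suc n) * (F j \<xi> * (if norm (T j \<xi>) < r n then 1 else 0)))) \<partial>lebesgue)"
    proof (rule nn_integral_mono)
      fix \<xi> :: "real^'n"
      let ?s = "\<lambda>n. ennreal (exp (R\<^sup>2 / 2)) * (of_nat (Suc n) * (F j \<xi> * (if norm (T j \<xi>) < r n then 1 else 0)))"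
      show "indicator (ball 0 R \<inter> {\<xi>. T j \<xi> \<notin> E}) \<xi> \<le> (\<Sum>n. ?s n)"
      proof (cases "\<xi> \<in> ball 0 R \<inter> {\<xi>. T j \<xi> \<notin> E}")
        case True
        then obtain n where n: "norm (T j \<xi>) < r n" "(cmod (g (T j \<xi>)))\<^sup>2 > 1 / real (Suc n)"
          by (auto simp: E_def not_le)
        have "norm \<xi> < R" using True by simp
        then have "(norm \<xi>)\<^sup>2 \<le> R\<^sup>2" by (intro power_mono) auto
        then have "1 \<le> exp (R\<^sup>2 / 2) * ?w \<xi>"
          unfolding exp_add[symmetric] by simp
        moreover have "1 \<le> real (Suc n) * (cmod (g (T j \<xi>)))\<^sup>2"
          using n(2) by (simp add: field_simps)
        ultimately have "1 * 1 \<le> (exp (R\<^sup>2 / 2) * ?w \<xi>) * (real (Suc n) * (cmod (g (T j \<xi>)))\<^sup>2)"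
          by (intro mult_mono) auto
        then have "1 \<le> ennreal (exp (R\<^sup>2 / 2) * (real (Suc n) * (?w \<xi> * (cmod (g (T j \<xi>)))\<^sup>2)))"
          by (simp add: mult_ac)
        also have "\<dots> = ?s n"
          using n(1) by (simp add: F_def ennreal_mult ennreal_of_nat_eq_real_of_nat del: of_nat_Suc)
        also have "\<dots> \<le> (\<Sum>n. ?s n)"
          using sum_le_suminf[of ?s "{n}"] by simp
        finally show ?thesis using True by simp
      qed simp
    qed
    also have "\<dots> = (\<Sum>n. \<integral>\<^sup>+\<xi>. ennreal (exp (R\<^sup>2 / 2)) * (of_nat (Suc n) * (F j \<xi> * (if norm (T j \<xi>) < r n then 1 else 0))) \<partial>lebesgue)"
      by (rule nn_integral_suminf) measurable
    also have "\<dots> = ennreal (exp (R\<^sup>2 / 2)) * D j"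
      unfolding D_def a_def ennreal_suminf_cmult[symmetric]
      by (intro suminf_cong) (subst nn_integral_cmult, measurable, subst nn_integral_cmult, measurable)
    finally show ?thesis .
  qed
  have ratio: "(\<lambda>j. measure lebesgue (E \<inter> T j ` ball 0 R) / measure lebesgue (T j ` ball 0 R)) \<longlonglongrightarrow> 1"
    if R: "R > 0" for R
  proof -
    define b where "b j = measure lebesgue (ball 0 R \<inter> {\<xi>. T j \<xi> \<notin> E})" for j
    define v where "v = measure lebesgue (ball (0::real^'n) R)"
    have v: "v > 0" using R by (simp add: v_def content_ball_pos)
    have "(\<lambda>j. ennreal (exp (R\<^sup>2 / 2)) * D j) \<longlonglongrightarrow> ennreal (exp (R\<^sup>2 / 2)) * 0"
      using \<open>D \<longlonglongrightarrow> 0\<close> by (intro ennreal_tendsto_cmult) auto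
    then have up: "(\<lambda>j. ennreal (exp (R\<^sup>2 / 2)) * D j) \<longlonglongrightarrow> 0" by simp
    have "(\<lambda>j. emeasure lebesgue (ball 0 R \<inter> {\<xi>. T j \<xi> \<notin> E})) \<longlonglongrightarrow> 0"
      by (rule tendsto_sandwich[OF _ _ tendsto_const up]) (simp_all add: bad)
    then have "(\<lambda>j. emeasure lebesgue (ball 0 R \<inter> {\<xi>. T j \<xi> \<notin> E})) \<longlonglongrightarrow> ennreal 0" by simp
    from tendsto_enn2real[OF this] have b0: "b \<longlonglongrightarrow> 0"
      by (simp add: b_def[abs_def] measure_def)
    \<comment> \<open>\<open>T j\<close> changes all volumes by the same factor, so the ratio may be
      computed after pulling back, where the ball no longer depends on \<open>j\<close>.\<close>
    have eq: "measure lebesgue (E \<inter> T j ` ball 0 R) / measure lebesgue (T j ` ball 0 R) = 1 - b j / v" for j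
    proof -
      let ?c = "1 / \<bar>det (matrix (T j))\<bar>" and ?V = "T j ` ball 0 R"
      have c: "?c > 0" using T(2)[of j] by simp
      have V: "?V \<in> sets lebesgue" using emeasure_linear_image(1)[OF T(1)[of j] T(2)[of j]] by simp
      have V_fin: "emeasure lebesgue ?V < \<infinity>"
      proof -
        have "emeasure lebesgue ?V = emeasure lborel ?V"
          using emeasure_linear_image(1)[OF T(1)[of j] T(2)[of j], of "ball 0 R"] by simp
        then show ?thesis using emeasure_linear_image(2)[OF T(1)[of j] T(2)[of j], of "ball 0 R"] emeasure_lborel_ball_finite[of "0::real^'n" R]
          by (simp add: ennreal_mult_less_top)
      qed
      have scale: "measure lebesgue (T j -` S) = ?c * measure lebesgue S" if S: "S \<in> sets lebesgue" for S
      proof -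
        have pre: "T j -` S \<in> sets lebesgue"
          using measurable_sets[OF Tm[OF measurable_ident, of j], of S] S by (simp add: id_def)
        have "emeasure lebesgue (T j -` S) = (\<integral>\<^sup>+\<xi>. indicator (T j -` S) \<xi> \<partial>lebesgue)"
          by (rule nn_integral_indicator[OF pre, symmetric])
        also have "\<dots> = (\<integral>\<^sup>+\<xi>. indicator S (T j \<xi>) \<partial>lebesgue)"
          by (intro nn_integral_cong) (auto simp: indicator_def)
        also have "\<dots> = ennreal ?c * emeasure lebesgue S"
          using nn_integral_lebesgue_affine[OF T(1)[of j] T(2)[of j], of "indicator S" 0]
            borel_measurable_indicator[OF S] nn_integral_indicator[OF S] by simp
        finally show ?thesis using c by (simp add: measure_def enn2real_mult)
      qed
      have preV: "T j -` ?V = ball 0 R" using T_inj by (simp add: inj_vimage_image_eq)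
      have preVE: "T j -` (?V - E) = ball 0 R \<inter> {\<xi>. T j \<xi> \<notin> E}" using preV by auto
      have "v = ?c * measure lebesgue ?V" using scale[OF V] unfolding preV v_def .
      moreover have "b j = ?c * measure lebesgue (?V - E)"
        using scale[of "?V - E"] V Em unfolding preVE b_def by blast
      moreover have "measure lebesgue (E \<inter> ?V) = measure lebesgue ?V - measure lebesgue (?V - E)"
      proof -
        have "measure lebesgue (?V - E) = measure lebesgue ?V - measure lebesgue (?V \<inter> E)"
          using V_fin V Em measure_Diff[of lebesgue ?V "?V \<inter> E"] by (simp add: Diff_Int_distrib less_top Diff_Int)
        then show ?thesis by (simp add: Int_commute)
      qed
      moreover define d where "d = \<bar>det (matrix (T j))\<bar>"
      moreover have "d > 0" using T(2)[of j] by (simp add: d_def)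
      ultimately have "measure lebesgue ?V = v * d" "measure lebesgue (E \<inter> ?V) = (v - b j) * d"
        by (simp_all add: field_simps)
      then show ?thesis using \<open>d > 0\<close> v by (simp add: field_simps)
    qed
    have "(\<lambda>j. 1 - b j / v) \<longlonglongrightarrow> 1 - 0 / v" by (intro tendsto_intros b0) (use v in auto)
    then show ?thesis unfolding eq by simp
  qed
  \<comment> \<open>For a null set all the ratios would be 0, but they tend to 1.\<close>
  have "emeasure lebesgue E > 0"
  proof (rule ccontr)
    assume "\<not> emeasure lebesgue E > 0"
    then have "E \<in> null_sets lebesgue" using Em by (auto simp: null_sets_def)
    then have "measure lebesgue (E \<inter> T j ` ball 0 1) = 0" for j
      by (metis completion.complete2 inf_le1 measure_eq_0_null_sets)
    then show False using ratio[of 1] by (simp add: LIMSEQ_const_iff)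
  qed
  then have "density_point_origin M E"
    unfolding density_point_origin_def int_funpow_minus_of_nat T_def[symmetric] using Em ratio by blast
  moreover have "((g(0 := 0)) \<longlongrightarrow> (g(0 := 0)) 0) (at 0 within E)"
    unfolding Lim_within
  proof (intro allI impI)
    fix e :: real assume e: "e > 0"
    obtain n where n: "1 / real (Suc n) < e\<^sup>2"
      using e reals_Archimedean[of "e\<^sup>2"] by (auto simp: inverse_eq_divide)
    have "cmod (g x) < e" if "x \<in> E" "norm x < r n" for x
    proof -
      have "(cmod (g x))\<^sup>2 \<le> 1 / real (Suc n)" using that unfolding E_def by blast
      also note n
      finally show ?thesis using e by (simp add: power2_less_imp_less)
    qed
    then show "\<exists>d>0. \<forall>x\<in>E. 0 < dist x 0 \<and> dist x 0 < d \<longrightarrow> dist ((g(0 := 0)) x) ((g(0 := 0)) 0) < e"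
      using r(1)[of n] by (intro exI[of _ "r n"]) auto
  qed
  ultimately show ?thesis unfolding approx_continuous_origin_def by blast
qed

section \<open>Decay of the dilated Fourier transforms\<close>

text \<open>A kernel vector, read as a complex vector, would be an eigenvector for 0, whose modulus
  is not above 1.\<close>

lemma expansive_dilation_det_nonzero:
  assumes "expansive_dilation A"
  shows "det (matrix A) \<noteq> 0"
proof
  assume "det (matrix A) = 0"
  moreover have lin: "linear A" using assms by (simp add: expansive_dilation_def)
  ultimately have "\<not> inj A" using det_nz_iff_inj by blast
  then obtain v where v: "v \<noteq> 0" "A v = 0" using lin linear_injective_0 by blast
  let ?v = "\<chi> i. complex_of_real (v $ i)"
  have "(\<chi> i j. complex_of_real (matrix A $ i $ j)) *v ?v = 0"
  proof -
    have "(\<Sum>j\<in>UNIV. matrix A $ i $ j * v $ j) = 0" for i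
    proof -
      have "matrix A *v v = 0" using v(2) fun_cong[OF matrix_vector_mul(2)[OF lin], of v] by simp
      then show ?thesis by (simp add: matrix_vector_mult_def vec_eq_iff)
    qed
    then have "complex_of_real (\<Sum>j\<in>UNIV. matrix A $ i $ j * v $ j) = 0" for i by simp
    then show ?thesis by (simp add: matrix_vector_mult_def vec_eq_iff)
  qed
  moreover have "?v \<noteq> 0" using v(1) by (auto simp: vec_eq_iff)
  ultimately have "complex_eigenvalue A 0"
    unfolding complex_eigenvalue_def by (intro exI[of _ ?v]) simp
  then show False using assms by (auto simp: expansive_dilation_def)
qed

lemma det_matrix_adjoint:
  fixes A :: "real^'n \<Rightarrow> real^'n"
  assumes "linear A"
  shows "det (matrix (adjoint A)) = det (matrix A)"
  using assms by (simp add: matrix_adjoint)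

section \<open>Wavelet coefficients of Gaussians\<close>

lemma wavelet_elem_nat:
  "wavelet_elem A \<psi> (int j) k x = complex_of_real (abs_det A powr (real j / 2)) * \<psi> ((A ^^ j) x - k)"
  by (simp add: wavelet_elem_def int_funpow_of_nat)

text \<open>The element with index \<open>k\<close> is the one with index 0 translated by
  \<open>inv (A ^^ j) k\<close>. Moving the translation onto the Gaussian turns the coefficients at
  scale \<open>j\<close> into samples of one function.\<close>

lemma L2_inner_wavelet_gauss:
  fixes A :: "real^'n \<Rightarrow> real^'n"
  assumes A: "linear A" "det (matrix A) \<noteq> 0" and \<psi>: "wavelet_elem A \<psi> (int j) 0 \<in> L2"
  shows "L2_inner (wavelet_elem A \<psi> (int j) k) (gauss y) =
    L2_inner (wavelet_elem A \<psi> (int j) 0) (gauss (y - inv (A ^^ j) k))"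
proof -
  let ?z = "inv (A ^^ j) k" and ?h = "\<lambda>x. wavelet_elem A \<psi> (int j) 0 x * cnj (gauss (y - inv (A ^^ j) k) x)"
  have T: "linear (A ^^ j)" "det (matrix (A ^^ j)) \<noteq> 0"
    using linear_funpow[OF A(1), of j] A(2) by auto
  have Tz: "(A ^^ j) (x - ?z) = (A ^^ j) x - k" for x
    using linear_bijection(1)[OF T] T(1) by (simp add: linear_diff bij_is_surj surj_f_inv_f)
  have h: "?h \<in> borel_measurable lebesgue"
    by (rule borel_measurable_integrable[OF L2_inner_integrable[OF \<psi> gauss_L2]])
  have "?h (x + (- ?z)) = wavelet_elem A \<psi> (int j) k x * cnj (gauss y x)" for x
    using Tz[of x] by (simp add: wavelet_elem_nat gauss_def)
  then have "L2_inner (wavelet_elem A \<psi> (int j) k) (gauss y) = (LINT x|lebesgue. ?h (x + (- ?z)))"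
    unfolding L2_inner_def by (intro Bochner_Integration.integral_cong) auto
  also have "\<dots> = (LINT x|lebesgue. ?h x)"
    using integral_lebesgue_affine[OF linear_identity _ h, of "- ?z"] by (simp add: det_matrix_identity)
  finally show ?thesis unfolding L2_inner_def .
qed

text \<open>The upper frame bound for the single function \<open>gauss y\<close>, restricted to one
  generator and to finitely many scales \<open>j \<ge> 0\<close>, is the hypothesis
  \<open>bound\<close> of the averaging lemma. Its right-hand side is the same for all
  \<open>y\<close>, since translation preserves the norm. The weight \<open>abs_det A ^ j\<close> is
  the density of the lattice of samples.\<close>

lemma tight_frame_gauss_average_bound:
  fixes A :: "real^'n \<Rightarrow> real^'n"
  assumes A: "linear A" "det (matrix A) \<noteq> 0"
    and frame: "tight_frame_multiwavelet A G N \<psi>" and \<alpha>: "\<alpha> \<in> {1..N}"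
  shows "(\<Sum>j<J. ennreal (abs_det A ^ j) *
      (\<integral>\<^sup>+y. ennreal ((cmod (L2_inner (wavelet_elem A (\<psi> \<alpha>) (int j) 0) (gauss y)))\<^sup>2) \<partial>lborel)) \<le>
    3 ^ CARD('n) * ennreal ((L2_norm (gauss (0::real^'n)))\<^sup>2)"
proof -
  let ?\<psi> = "\<lambda>j k. wavelet_elem A (\<psi> \<alpha>) (int j) k"
  define P where "P j y = ennreal ((cmod (L2_inner (?\<psi> j 0) (gauss y)))\<^sup>2)" for j y
  have L2: "?\<psi> j 0 \<in> L2" for j
  proof -
    have "?\<psi> j 0 \<in> affine_system A N \<psi>"
      using \<alpha> unfolding affine_system_def int_lattice_def by force
    then show ?thesis using frame H2_L2 unfolding tight_frame_multiwavelet_def by blast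
  qed
  have "(\<Sum>j<J. ennreal \<bar>det (matrix (A ^^ j))\<bar> * (\<integral>\<^sup>+y. P j y \<partial>lborel)) \<le> 3 ^ CARD('n) * ennreal ((L2_norm (gauss (0::real^'n)))\<^sup>2)"
  proof (rule sum_nn_integral_le_of_lattice_bound)
    show "P j \<in> borel_measurable borel" for j
      using gauss_average_measurable[OF L2[of j]] unfolding P_def by measurable
    show "linear (A ^^ j)" "det (matrix (A ^^ j)) \<noteq> 0" for j
      using linear_funpow[OF A(1), of j] A(2) by auto
    fix K :: "nat \<Rightarrow> (real^'n) set" and y
    assume K: "\<And>j. finite (K j)" "\<And>j. K j \<subseteq> int_lattice"
    let ?F = "(\<lambda>(j, k). (\<alpha>, int j, k)) ` (SIGMA j:{..<J}. K j)"
    have inj: "inj_on (\<lambda>(j, k). (\<alpha>, int j, k)) (SIGMA j:{..<J}. K j)"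
      by (auto simp: inj_on_def)
    have "(\<Sum>(\<alpha>, j, k)\<in>?F. (cmod (L2_inner (gauss y) (wavelet_elem A (\<psi> \<alpha>) j k)))\<^sup>2) \<le> (L2_norm (gauss y))\<^sup>2"
      by (rule tight_frame_Bessel[OF frame gauss_L2]) (use K \<alpha> in auto)
    also have "(\<Sum>(\<alpha>, j, k)\<in>?F. (cmod (L2_inner (gauss y) (wavelet_elem A (\<psi> \<alpha>) j k)))\<^sup>2) =
        (\<Sum>(j, k)\<in>(SIGMA j:{..<J}. K j). (cmod (L2_inner (gauss y) (?\<psi> j k)))\<^sup>2)"
      by (subst sum.reindex[OF inj]) (simp add: case_prod_beta)
    also have "\<dots> = (\<Sum>j<J. \<Sum>k\<in>K j. (cmod (L2_inner (gauss y) (?\<psi> j k)))\<^sup>2)"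
      using K by (subst sum.Sigma) auto
    also have "\<dots> = (\<Sum>j<J. \<Sum>k\<in>K j. (cmod (L2_inner (?\<psi> j 0) (gauss (y - inv (A ^^ j) k))))\<^sup>2)"
    proof (intro sum.cong refl)
      fix j k
      have "cmod (L2_inner (gauss y) (?\<psi> j k)) = cmod (L2_inner (?\<psi> j k) (gauss y))"
        by (subst L2_inner_commute) simp
      also have "L2_inner (?\<psi> j k) (gauss y) = L2_inner (?\<psi> j 0) (gauss (y - inv (A ^^ j) k))"
        by (rule L2_inner_wavelet_gauss[OF A L2])
      finally show "(cmod (L2_inner (gauss y) (?\<psi> j k)))\<^sup>2 = (cmod (L2_inner (?\<psi> j 0) (gauss (y - inv (A ^^ j) k))))\<^sup>2"
        by simp
    qed
    finally show "(\<Sum>j<J. \<Sum>k\<in>K j. P j (y - inv (A ^^ j) k)) \<le> ennreal ((L2_norm (gauss (0::real^'n)))\<^sup>2)"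
      unfolding P_def gauss_norm[of y] by (simp add: sum_nonneg)
  qed
  then show ?thesis unfolding P_def linear_funpow(2)[OF A(1)] abs_det_def power_abs .
qed

lemma ennreal_tendsto_zero_of_bounded_sums:
  fixes f :: "nat \<Rightarrow> ennreal"
  assumes bound: "\<And>n. (\<Sum>j<n. f j) \<le> B" and B: "B < \<top>"
  shows "f j < \<top>" "f \<longlonglongrightarrow> 0"
proof -
  have fin: "f j < \<top>" for j
  proof -
    have "f j \<le> (\<Sum>j<Suc j. f j)" by simp
    also have "\<dots> \<le> B" by (rule bound)
    finally show ?thesis using B by (rule le_less_trans)
  qed
  then show "f j < \<top>" .
  have f: "ennreal (enn2real (f j)) = f j" for j using fin by simp
  have "(\<Sum>j<n. enn2real (f j)) \<le> enn2real B" for n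
  proof -
    have "ennreal (\<Sum>j<n. enn2real (f j)) = (\<Sum>j<n. f j)"
      by (subst sum_ennreal[symmetric]) (auto simp: f)
    then have "ennreal (\<Sum>j<n. enn2real (f j)) \<le> ennreal (enn2real B)"
      using bound[of n] B by simp
    then show ?thesis by (simp add: ennreal_le_iff)
  qed
  then have "summable (\<lambda>j. enn2real (f j))"
    by (intro summableI_nonneg_bounded) auto
  then have "(\<lambda>j. ennreal (enn2real (f j))) \<longlonglongrightarrow> ennreal 0"
    by (intro tendsto_ennrealI summable_LIMSEQ_zero)
  then show "f \<longlonglongrightarrow> 0" by (simp add: f)
qed

lemma inv_adjoint_funpow_inner:
  fixes A :: "real^'n \<Rightarrow> real^'n"
  assumes A: "linear A" "det (matrix A) \<noteq> 0"
  shows "(A ^^ j) x \<bullet> (inv (adjoint A) ^^ j) \<xi> = x \<bullet> \<xi>"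
proof (induction j arbitrary: x \<xi>)
  case (Suc j)
  have "bij (adjoint A)"
    using linear_bijection(1)[OF adjoint_linear[OF A(1)]] A by (simp add: det_matrix_adjoint)
  then have adj: "adjoint A (inv (adjoint A) \<eta>) = \<eta>" for \<eta>
    by (simp add: bij_is_surj surj_f_inv_f)
  have "(A ^^ Suc j) x \<bullet> (inv (adjoint A) ^^ Suc j) \<xi> =
      A ((A ^^ j) x) \<bullet> inv (adjoint A) ((inv (adjoint A) ^^ j) \<xi>)" by simp
  also have "\<dots> = (A ^^ j) x \<bullet> (inv (adjoint A) ^^ j) \<xi>"
    using adjoint_works[OF A(1), of "(A ^^ j) x" "inv (adjoint A) ((inv (adjoint A) ^^ j) \<xi>)"]
    by (simp add: adj)
  also have "\<dots> = x \<bullet> \<xi>" by (rule Suc.IH)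
  finally show ?case .
qed simp

text \<open>Each \<open>I j\<close> is at most a constant times the \<open>j\<close>-th term of the
  sum in \<open>tight_frame_gauss_average_bound\<close>, so the series converges and its terms tend
  to 0.\<close>

lemma weighted_dilated_fourier_decay:
  fixes A :: "real^'n \<Rightarrow> real^'n"
  assumes A: "linear A" "det (matrix A) \<noteq> 0"
    and frame: "tight_frame_multiwavelet A G N \<psi>" and \<alpha>: "\<alpha> \<in> {1..N}"
    and g: "is_L2_fourier (\<psi> \<alpha>) g"
  defines "I \<equiv> \<lambda>j. \<integral>\<^sup>+\<xi>. ennreal (exp (- (norm \<xi>)\<^sup>2 / 2) * (cmod (g ((inv (adjoint A) ^^ j) \<xi>)))\<^sup>2) \<partial>lebesgue"
  shows "I j < \<top>" "I \<longlonglongrightarrow> 0"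
proof -
  let ?d = "abs_det A"
  have d: "?d > 0" using A by (simp add: abs_det_def)
  obtain C where C: "C \<ge> 0" and C_bound: "\<And>(f :: real^'n \<Rightarrow> complex) g. is_L2_fourier f g \<Longrightarrow>
    (\<integral>\<^sup>+\<xi>. ennreal (exp (- (norm \<xi>)\<^sup>2 / 2) * (cmod (g \<xi>))\<^sup>2) \<partial>lebesgue) \<le>
      ennreal C * (\<integral>\<^sup>+t. ennreal ((cmod (L2_inner f (gauss t)))\<^sup>2) \<partial>lborel)"
    by (rule weighted_fourier_le_gauss_average) (rule that)
  define R where "R j = (\<integral>\<^sup>+y. ennreal ((cmod (L2_inner (wavelet_elem A (\<psi> \<alpha>) (int j) 0) (gauss y)))\<^sup>2) \<partial>lborel)" for j
  have I_le: "I j \<le> ennreal C * (ennreal (?d ^ j) * R j)" for j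
  proof -
    let ?T = "A ^^ j" and ?T' = "inv (adjoint A) ^^ j"
    have T: "linear ?T" "det (matrix ?T) \<noteq> 0" "\<bar>det (matrix ?T)\<bar> = ?d ^ j"
      using linear_funpow[OF A(1), of j] A(2) by (auto simp: abs_det_def power_abs)
    have adj: "linear (adjoint A)" "det (matrix (adjoint A)) \<noteq> 0"
      using adjoint_linear[OF A(1)] A by (auto simp: det_matrix_adjoint)
    note bij = linear_bijection[OF adj]
    have "det (matrix (inv (adjoint A))) \<noteq> 0"
      using bij by (simp add: det_nz_iff_inj bij_is_inj bij_imp_bij_inv)
    then have T': "linear ?T'" "det (matrix ?T') \<noteq> 0"
      using linear_funpow[OF bij(2), of j] by auto
    let ?c = "complex_of_real (?d powr (real j / 2))"
    have "is_L2_fourier (\<lambda>x. ?c * \<psi> \<alpha> (?T x)) (\<lambda>\<xi>. ?c * (complex_of_real (1 / \<bar>det (matrix ?T)\<bar>) * g (?T' \<xi>)))"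
      by (intro is_L2_fourier_scale is_L2_fourier_dilate T T' inv_adjoint_funpow_inner A g)
    moreover have "(\<lambda>x. ?c * \<psi> \<alpha> (?T x)) = wavelet_elem A (\<psi> \<alpha>) (int j) 0"
      by (simp add: wavelet_elem_nat fun_eq_iff)
    ultimately have "is_L2_fourier (wavelet_elem A (\<psi> \<alpha>) (int j) 0) (\<lambda>\<xi>. ?c * (complex_of_real (1 / \<bar>det (matrix ?T)\<bar>) * g (?T' \<xi>)))"
      by simp
    then have "(\<integral>\<^sup>+\<xi>. ennreal (exp (- (norm \<xi>)\<^sup>2 / 2) * (cmod (?c * (complex_of_real (1 / \<bar>det (matrix ?T)\<bar>) * g (?T' \<xi>))))\<^sup>2) \<partial>lebesgue)
        \<le> ennreal C * R j"
      unfolding R_def by (rule C_bound)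
    \<comment> \<open>The normalisation contributes \<open>?d ^ j\<close> to the square and the
      dilation rule \<open>?d ^ j\<close> to the power -2. The remaining \<open>1 / ?d ^ j\<close>
      is what the lattice density compensates.\<close>
    moreover have "(cmod (?c * (complex_of_real (1 / \<bar>det (matrix ?T)\<bar>) * g (?T' \<xi>))))\<^sup>2 = (cmod (g (?T' \<xi>)))\<^sup>2 / ?d ^ j" for \<xi>
    proof -
      have "(?d powr (real j / 2))\<^sup>2 = ?d ^ j"
        using d by (simp add: powr_power[of ?d] powr_realpow)
      then show ?thesis
        using d unfolding T(3) norm_mult norm_of_real power_mult_distrib power2_abs
        by (simp add: power_divide power2_eq_square)
    qed
    ultimately have le: "(\<integral>\<^sup>+\<xi>. ennreal (exp (- (norm \<xi>)\<^sup>2 / 2) * ((cmod (g (?T' \<xi>)))\<^sup>2 / ?d ^ j)) \<partial>lebesgue) \<le> ennreal C * R j"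
      by simp
    have m: "(\<lambda>\<xi>. ennreal (exp (- (norm \<xi>)\<^sup>2 / 2) * ((cmod (g (?T' \<xi>)))\<^sup>2 / ?d ^ j))) \<in> borel_measurable lebesgue"
    proof -
      have [measurable]: "(\<lambda>\<xi>. g (?T' \<xi>)) \<in> borel_measurable lebesgue"
        using measurable_lebesgue_affine[OF T' L2_measurable[OF is_L2_fourier_L2(2)[OF g]], of 0] by simp
      have [measurable]: "(\<lambda>\<xi>::real^'n. exp (- (norm \<xi>)\<^sup>2 / 2)) \<in> borel_measurable lebesgue"
        by (intro measurable_completion) simp
      show ?thesis by measurable
    qed
    have "I j = (\<integral>\<^sup>+\<xi>. ennreal (?d ^ j) * ennreal (exp (- (norm \<xi>)\<^sup>2 / 2) * ((cmod (g (?T' \<xi>)))\<^sup>2 / ?d ^ j)) \<partial>lebesgue)"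
      unfolding I_def using d by (intro nn_integral_cong) (simp flip: ennreal_mult)
    also have "\<dots> = ennreal (?d ^ j) * (\<integral>\<^sup>+\<xi>. ennreal (exp (- (norm \<xi>)\<^sup>2 / 2) * ((cmod (g (?T' \<xi>)))\<^sup>2 / ?d ^ j)) \<partial>lebesgue)"
      by (rule nn_integral_cmult[OF m])
    also have "\<dots> \<le> ennreal (?d ^ j) * (ennreal C * R j)"
      by (intro mult_left_mono le) auto
    finally show ?thesis by (simp add: mult_ac)
  qed
  let ?B = "ennreal C * (3 ^ CARD('n) * ennreal ((L2_norm (gauss (0::real^'n)))\<^sup>2))"
  have bound: "(\<Sum>j<J. I j) \<le> ?B" for J
  proof -
    have "(\<Sum>j<J. I j) \<le> (\<Sum>j<J. ennreal C * (ennreal (?d ^ j) * R j))" by (intro sum_mono I_le)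
    also have "\<dots> = ennreal C * (\<Sum>j<J. ennreal (?d ^ j) * R j)" by (rule sum_distrib_left[symmetric])
    also have "\<dots> \<le> ?B"
      unfolding R_def by (intro mult_left_mono tight_frame_gauss_average_bound[OF A frame \<alpha>]) auto
    finally show ?thesis .
  qed
  have "?B < \<top>" by (simp add: ennreal_mult_less_top power_less_top_ennreal)
  from ennreal_tendsto_zero_of_bounded_sums[OF bound this] show "I j < \<top>" "I \<longlonglongrightarrow> 0" by auto
qed

theorem theorem4p2:
  fixes A :: "real^'n \<Rightarrow> real^'n" and G :: "(real^'n) set"
    and N :: nat and \<psi> :: "nat \<Rightarrow> real^'n \<Rightarrow> complex"
    and \<alpha> :: nat and g :: "real^'n \<Rightarrow> complex"
  assumes "expansive_dilation A"
    and "G \<in> sets lebesgue" and "adjoint A ` G = G"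
    and "tight_frame_multiwavelet A G N \<psi>" and "semiorthogonal A N \<psi>"
    and "\<alpha> \<in> {1..N}" and "is_L2_fourier (\<psi> \<alpha>) g"
  shows "approx_continuous_origin (adjoint A) (g(0 := 0))"

proof -
  have A: "linear A" "det (matrix A) \<noteq> 0"
    using assms(1) expansive_dilation_det_nonzero by (auto simp: expansive_dilation_def)
  have M: "linear (adjoint A)" "det (matrix (adjoint A)) \<noteq> 0"
    using adjoint_linear[OF A(1)] A by (auto simp: det_matrix_adjoint)
  show ?thesis
    using weighted_dilated_fourier_decay[OF A assms(4,6,7)]
    by (intro approx_continuous_origin_of_decay[OF M]
        L2_measurable[OF is_L2_fourier_L2(2)[OF assms(7)]]) auto
qed

end
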